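(* Let $q\in(0,1)$ and $n\in\mathbb{N}$. For the Bott projections $P_{\pm n}\in\mathrm{Mat}_2(C(\mathrm{S}^2_q))$ and the Powers--Rieffel type projection $R_n\in C_0(\mathbb{C}_q)\subset C(\mathrm{S}^2_q)$ defined in the context, the following equalities hold in $K_0(C(\mathrm{S}^2_q))$: $$[P_n]=[1]+[R_n]=\left[\begin{pmatrix}R_n&0\\0&1\end{pmatrix}\right],\qquad[P_{-n}]=[1-R_n].$$
   Context: **Algebra.** Fix $q\in(0,1)$. Put $\alpha_q(f)(x):=f(qx)$. The crossed product $C_0([0,\infty))\rtimes\mathbb{Z}$ is the enveloping C*-algebra of the *-algebra of finite sums $\sum_kf_kU^k$, $f_k\in C_0([0,\infty))$, $k\in\mathbb{Z}$, where $U$ is a unitary with $UfU^*=\alpha_q(f)$. Define $$C_0(\mathbb{C}_q):=\text{norm closure of }\Big\{\sum_{\text{finite}}f_kU^k\in C_0([0,\infty))\rtimes\mathbb{Z}: f_k(0)=0\text{ if }k\neq0\Big\},$$ and let $C(\mathrm{S}^2_q):=C_0(\mathbb{C}_q)\dotplus\mathbb{C}\mathbf{1}$ be its unitization, i.e. the norm closure of the finite sums $\sum f_kU^k\in C([0,\infty])\rtimes\mathbb{Z}$ with $f_k(0)=f_k(\infty)=0$ for $k\neq0$ (with $\alpha_q$ fixing $\infty$). **Bott projections.** Write $t$ for the coordinate function on $[0,\infty)$ (corresponding to $|z|$), and regard rational functions of $t$ as continuous functions on $[0,\infty]$. For $n\in\mathbb{N}=\{1,2,\dots\}$ let $$P_n=\begin{pmatrix}\frac{q^{-n(n-1)}t^{2n}}{1+q^{-n(n-1)}t^{2n}}&\frac{q^{-\frac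 n2(n-1)}t^n}{1+q^{-n(n-1)}t^{2n}}U^{*n}\\[6pt]\frac{q^{\frac n2(n+1)}t^n}{1+q^{n(n+1)}t^{2n}}U^n&\frac{1}{1+q^{n(n+1)}t^{2n}}\end{pmatrix},\qquad P_{-n}=\begin{pmatrix}\frac{q^{n(n+1)}t^{2n}}{1+q^{n(n+1)}t^{2n}}&\frac{q^{\frac n2(n+1)}t^n}{1+q^{n(n+1)}t^{2n}}U^n\\[6pt]\frac{q^{-\frac n2(n-1)}t^n}{1+q^{-n(n-1)}t^{2n}}U^{*n}&\frac{1}{1+q^{-n(n-1)}t^{2n}}\end{pmatrix}.$$ These are self-adjoint projections in $\mathrm{Mat}_2(C(\mathrm{S}^2_q))$. **Powers--Rieffel type projections.** Choose a continuous $\phi:[q,1]\to\mathbb{R}$ with $0\le\phi\le1$, $\phi(q)=0$, $\phi(1)=1$. Let $h(t)=\sqrt{\phi(t)(1-\phi(t))}$ for $t\in[q,1]$ and $h(t)=0$ otherwise. For $n\in\mathbb{N}$ let $f_n(t)=\phi(t)$ for $t\in[q,1]$, $f_n(t)=1$ for $t\in(1,q^{-n+1})$, $f_n(t)=1-\phi(q^nt)$ for $t\in[q^{-n+1},q^{-n}]$, and $f_n(t)=0$ for $t\notin[q,q^{-n}]$. Then $R_n:=U^nh+f_n+hU^{*n}\in C_0(\mathbb{C}_q)$ is a self-adjoint projection. *)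

theory Defs
  imports
    "HOL-Analysis.Analysis"
    "HOL-Algebra.Module"
    "Jordan_Normal_Form.Matrix"
begin

section \<open>Enveloping C*-algebras\<close>

record 'a star_algebra = "(complex, 'a) module" +
  adj :: "'a \<Rightarrow> 'a"

definition cstar_seminorm :: "('a, 'b) star_algebra_scheme \<Rightarrow> ('a \<Rightarrow> real) \<Rightarrow> bool" where
  "cstar_seminorm A p \<longleftrightarrow>
     (\<forall>x\<in>carrier A. 0 \<le> p x) \<and>
     (\<forall>x\<in>carrier A. \<forall>y\<in>carrier A. p (x \<oplus>\<^bsub>A\<^esub> y) \<le> p x + p y) \<and>
     (\<forall>c. \<forall>x\<in>carrier A. p (c \<odot>\<^bsub>A\<^esub> x) = cmod c * p x) \<and>
     (\<forall>x\<in>carrier A. \<forall>y\<in>carrier A. p (x \<otimes>\<^bsub>A\<^esub> y) \<le> p x * p y) \<and>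
     (\<forall>x\<in>carrier A. p (adj A x \<otimes>\<^bsub>A\<^esub> x) = (p x)\<^sup>2)"

text \<open>
  The universal C*-seminorm. Hilbert space representations and C*-seminorms give the same
  supremum. It is a supremum in \<^typ>\<open>real\<close>, so it is meaningful only if the C*-seminorms are
  pointwise bounded; for the crossed product below they are bounded by the sum of the sup norms
  of the coefficients.
\<close>

definition env_norm :: "('a, 'b) star_algebra_scheme \<Rightarrow> 'a \<Rightarrow> real" where
  "env_norm A x = (SUP p \<in> {p. cstar_seminorm A p}. p x)"

definition env_cauchy :: "('a, 'b) star_algebra_scheme \<Rightarrow> (nat \<Rightarrow> 'a) set" where
  "env_cauchy A = {s. range s \<subseteq> carrier A \<and>
     (\<forall>e>0. \<exists>N. \<forall>m\<ge>N. \<forall>n\<ge>N. env_norm A (s m \<ominus>\<^bsub>A\<^esub> s n) < e)}"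

definition env_rel :: "('a, 'b) star_algebra_scheme \<Rightarrow> ((nat \<Rightarrow> 'a) \<times> (nat \<Rightarrow> 'a)) set" where
  "env_rel A = {(s, t). s \<in> env_cauchy A \<and> t \<in> env_cauchy A \<and>
     (\<lambda>n. env_norm A (s n \<ominus>\<^bsub>A\<^esub> t n)) \<longlonglongrightarrow> 0}"

text \<open>
  The Hausdorff completion with respect to \<^const>\<open>env_norm\<close>, as Cauchy sequences modulo null
  sequences; null vectors of the seminorm are divided out at the same time.
\<close>

definition env_embed :: "('a, 'b) star_algebra_scheme \<Rightarrow> 'a \<Rightarrow> (nat \<Rightarrow> 'a) set" where
  "env_embed A a = env_rel A `` {\<lambda>_. a}"

definition enveloping :: "('a, 'b) star_algebra_scheme \<Rightarrow> (nat \<Rightarrow> 'a) set star_algebra" where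
  "enveloping A =
     \<lparr>carrier = env_cauchy A // env_rel A,
      mult = (\<lambda>X Y. \<Union>s\<in>X. \<Union>t\<in>Y. env_rel A `` {\<lambda>n. s n \<otimes>\<^bsub>A\<^esub> t n}),
      one = env_embed A \<one>\<^bsub>A\<^esub>,
      zero = env_embed A \<zero>\<^bsub>A\<^esub>,
      add = (\<lambda>X Y. \<Union>s\<in>X. \<Union>t\<in>Y. env_rel A `` {\<lambda>n. s n \<oplus>\<^bsub>A\<^esub> t n}),
      smult = (\<lambda>c X. \<Union>s\<in>X. env_rel A `` {\<lambda>n. c \<odot>\<^bsub>A\<^esub> s n}),
      adj = (\<lambda>X. \<Union>s\<in>X. env_rel A `` {\<lambda>n. adj A (s n)})\<rparr>"

definition completion_norm :: "('a, 'b) star_algebra_scheme \<Rightarrow> (nat \<Rightarrow> 'a) set \<Rightarrow> real" where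
  "completion_norm A X = lim (\<lambda>n. env_norm A ((SOME s. s \<in> X) n))"

definition env_closure :: "('a, 'b) star_algebra_scheme \<Rightarrow> 'a set \<Rightarrow> (nat \<Rightarrow> 'a) set set" where
  "env_closure A S = {X \<in> carrier (enveloping A).
     \<forall>e>0. \<exists>b\<in>S. completion_norm A (X \<ominus>\<^bsub>enveloping A\<^esub> env_embed A b) < e}"


section \<open>The K0-group of a unital *-algebra\<close>

definition mat_over :: "('a, 'b) star_algebra_scheme \<Rightarrow> nat \<Rightarrow> nat \<Rightarrow> 'a mat set" where
  "mat_over A m n = {M \<in> carrier_mat m n. \<forall>i<m. \<forall>j<n. M $$ (i, j) \<in> carrier A}"

definition mmul :: "('a, 'b) star_algebra_scheme \<Rightarrow> 'a mat \<Rightarrow> 'a mat \<Rightarrow> 'a mat" where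
  "mmul A M N = mat (dim_row M) (dim_col N)
     (\<lambda>(i, j). \<Oplus>\<^bsub>A\<^esub>k\<in>{..<dim_col M}. M $$ (i, k) \<otimes>\<^bsub>A\<^esub> N $$ (k, j))"

definition madj :: "('a, 'b) star_algebra_scheme \<Rightarrow> 'a mat \<Rightarrow> 'a mat" where
  "madj A M = mat (dim_col M) (dim_row M) (\<lambda>(i, j). adj A (M $$ (j, i)))"

definition dsum :: "('a, 'b) star_algebra_scheme \<Rightarrow> 'a mat \<Rightarrow> 'a mat \<Rightarrow> 'a mat" where
  "dsum A M N = four_block_mat M (mat (dim_row M) (dim_col N) (\<lambda>_. \<zero>\<^bsub>A\<^esub>))
                               (mat (dim_row N) (dim_col M) (\<lambda>_. \<zero>\<^bsub>A\<^esub>)) N"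

definition projs :: "('a, 'b) star_algebra_scheme \<Rightarrow> 'a mat set" where
  "projs A = {p. p \<in> mat_over A (dim_row p) (dim_row p) \<and> madj A p = p \<and> mmul A p p = p}"

text \<open>Murray--von Neumann equivalence of projections of possibly different sizes.\<close>

definition mvn_equiv :: "('a, 'b) star_algebra_scheme \<Rightarrow> 'a mat \<Rightarrow> 'a mat \<Rightarrow> bool" where
  "mvn_equiv A p r \<longleftrightarrow>
     (\<exists>v \<in> mat_over A (dim_row p) (dim_row r). mmul A v (madj A v) = p \<and> mmul A (madj A v) v = r)"

text \<open>
  The Grothendieck group of the monoid of equivalence classes of projections: a pair \<open>(p, r)\<close>
  stands for the formal difference \<open>[p] - [r]\<close>. The group is written multiplicatively, as
  a \<^type>\<open>monoid\<close> record, and its operation is induced by the direct sum of projections.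
\<close>

definition K0_rel :: "('a, 'b) star_algebra_scheme \<Rightarrow> (('a mat \<times> 'a mat) \<times> ('a mat \<times> 'a mat)) set" where
  "K0_rel A = {((p, r), (p', r')).
     p \<in> projs A \<and> r \<in> projs A \<and> p' \<in> projs A \<and> r' \<in> projs A \<and>
     (\<exists>s \<in> projs A. mvn_equiv A (dsum A (dsum A p r') s) (dsum A (dsum A p' r) s))}"

definition zero_proj :: "('a, 'b) star_algebra_scheme \<Rightarrow> 'a mat" where
  "zero_proj A = mat 1 1 (\<lambda>_. \<zero>\<^bsub>A\<^esub>)"

definition K0 :: "('a, 'b) star_algebra_scheme \<Rightarrow> ('a mat \<times> 'a mat) set monoid" where
  "K0 A =
     \<lparr>carrier = (projs A \<times> projs A) // K0_rel A,
      mult = (\<lambda>X Y. \<Union>(p, r)\<in>X. \<Union>(p', r')\<in>Y. K0_rel A `` {(dsum A p p', dsum A r r')}),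
      one = K0_rel A `` {(zero_proj A, zero_proj A)}\<rparr>"

definition K0_class :: "('a, 'b) star_algebra_scheme \<Rightarrow> 'a mat \<Rightarrow> ('a mat \<times> 'a mat) set" where
  "K0_class A p = K0_rel A `` {(p, zero_proj A)}"

definition mat1 :: "'a \<Rightarrow> 'a mat" where
  "mat1 a = mat_of_rows_list 1 [[a]]"

definition mat2 :: "'a \<Rightarrow> 'a \<Rightarrow> 'a \<Rightarrow> 'a \<Rightarrow> 'a mat" where
  "mat2 a b c d = mat_of_rows_list 2 [[a, b], [c, d]]"


section \<open>The crossed product and the quantum sphere\<close>

text \<open>
  The space \<open>[0,\<infinity>]\<close> is \<^typ>\<open>ennreal\<close>. The integer powers of the automorphism
  are \<open>\<alpha>\<^sub>q\<^sup>k(f)(x) = f(q\<^sup>k x)\<close>, and \<open>q\<^sup>k \<cdot> \<infinity> = \<infinity>\<close> since \<open>q > 0\<close>.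
\<close>

definition alpha :: "real \<Rightarrow> int \<Rightarrow> (ennreal \<Rightarrow> complex) \<Rightarrow> ennreal \<Rightarrow> complex" where
  "alpha q k f = (\<lambda>x. f (ennreal (q powi k) * x))"

type_synonym fin_sum = "int \<Rightarrow> ennreal \<Rightarrow> complex"

text \<open>
  The *-algebra of finite sums \<open>\<Sum>\<^sub>k f\<^sub>k U\<^sup>k\<close> with \<open>f\<^sub>k \<in> C([0,\<infinity>])\<close>, represented by the
  coefficient family \<open>k \<mapsto> f\<^sub>k\<close>. The operations follow from
  \<open>f U\<^sup>k \<cdot> g U\<^sup>l = f \<alpha>\<^sub>q\<^sup>k(g) U\<^sup>k\<^sup>+\<^sup>l\<close> and \<open>(f U\<^sup>k)\<^sup>* = \<alpha>\<^sub>q\<^sup>-\<^sup>k(cnj f) U\<^sup>-\<^sup>k\<close>.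
\<close>

definition crossed :: "real \<Rightarrow> fin_sum star_algebra" where
  "crossed q =
     \<lparr>carrier = {a. finite {k. a k \<noteq> (\<lambda>_. 0)} \<and> (\<forall>k. continuous_on UNIV (a k))},
      mult = (\<lambda>a b m x. \<Sum>k | a k \<noteq> (\<lambda>_. 0). a k x * alpha q k (b (m - k)) x),
      one = (\<lambda>k _. if k = 0 then 1 else 0),
      zero = (\<lambda>_ _. 0),
      add = (\<lambda>a b k x. a k x + b k x),
      smult = (\<lambda>c a k x. c * a k x),
      adj = (\<lambda>a k. alpha q k (\<lambda>x. cnj (a (- k) x)))\<rparr>"

definition sphere_sums :: "real \<Rightarrow> fin_sum set" where
  "sphere_sums q = {a \<in> carrier (crossed q). \<forall>k. k \<noteq> 0 \<longrightarrow> a k 0 = 0 \<and> a k \<infinity> = 0}"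

definition C_sphere :: "real \<Rightarrow> (nat \<Rightarrow> fin_sum) set star_algebra" where
  "C_sphere q = (enveloping (crossed q))\<lparr>carrier := env_closure (crossed q) (sphere_sums q)\<rparr>"

abbreviation sph :: "real \<Rightarrow> fin_sum \<Rightarrow> (nat \<Rightarrow> fin_sum) set" where
  "sph q \<equiv> env_embed (crossed q)"

text \<open>The value at \<open>\<infinity>\<close> is the limit; in particular functions vanishing at infinity get value 0.\<close>

definition ext_fun :: "(real \<Rightarrow> real) \<Rightarrow> ennreal \<Rightarrow> complex" where
  "ext_fun f x = complex_of_real (if x = \<infinity> then Lim at_top f else f (enn2real x))"

definition Fn :: "(real \<Rightarrow> real) \<Rightarrow> fin_sum" where
  "Fn f = (\<lambda>k. if k = 0 then ext_fun f else (\<lambda>_. 0))"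

definition U :: fin_sum where
  "U = (\<lambda>k _. if k = 1 then 1 else 0)"


section \<open>Bott projections\<close>

definition bott_pos :: "real \<Rightarrow> nat \<Rightarrow> (nat \<Rightarrow> fin_sum) set mat" where
  "bott_pos q n = (let
      A = crossed q;
      Uk = U [^]\<^bsub>A\<^esub> n;
      Vk = adj A U [^]\<^bsub>A\<^esub> n;
      a = q powr (- real n * (real n - 1));
      b = q powr (real n * (real n + 1));
      a' = q powr (- real n / 2 * (real n - 1));
      b' = q powr (real n / 2 * (real n + 1))
    in map_mat (sph q) (mat2
      (Fn (\<lambda>t. a * t ^ (2 * n) / (1 + a * t ^ (2 * n))))
      (Fn (\<lambda>t. a' * t ^ n / (1 + a * t ^ (2 * n))) \<otimes>\<^bsub>A\<^esub> Vk)
      (Fn (\<lambda>t. b' * t ^ n / (1 + b * t ^ (2 * n))) \<otimes>\<^bsub>A\<^esub> Uk)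
      (Fn (\<lambda>t. 1 / (1 + b * t ^ (2 * n))))))"

definition bott_neg :: "real \<Rightarrow> nat \<Rightarrow> (nat \<Rightarrow> fin_sum) set mat" where
  "bott_neg q n = (let
      A = crossed q;
      Uk = U [^]\<^bsub>A\<^esub> n;
      Vk = adj A U [^]\<^bsub>A\<^esub> n;
      a = q powr (- real n * (real n - 1));
      b = q powr (real n * (real n + 1));
      a' = q powr (- real n / 2 * (real n - 1));
      b' = q powr (real n / 2 * (real n + 1))
    in map_mat (sph q) (mat2
      (Fn (\<lambda>t. b * t ^ (2 * n) / (1 + b * t ^ (2 * n))))
      (Fn (\<lambda>t. b' * t ^ n / (1 + b * t ^ (2 * n))) \<otimes>\<^bsub>A\<^esub> Uk)
      (Fn (\<lambda>t. a' * t ^ n / (1 + a * t ^ (2 * n))) \<otimes>\<^bsub>A\<^esub> Vk)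
      (Fn (\<lambda>t. 1 / (1 + a * t ^ (2 * n))))))"


section \<open>Powers--Rieffel type projections\<close>

definition pr_h :: "real \<Rightarrow> (real \<Rightarrow> real) \<Rightarrow> real \<Rightarrow> real" where
  "pr_h q \<phi> t = (if t \<in> {q..1} then sqrt (\<phi> t * (1 - \<phi> t)) else 0)"

definition pr_f :: "real \<Rightarrow> (real \<Rightarrow> real) \<Rightarrow> nat \<Rightarrow> real \<Rightarrow> real" where
  "pr_f q \<phi> n t =
     (if t \<in> {q..1} then \<phi> t
      else if t \<in> {1<..<q powr (- real n + 1)} then 1
      else if t \<in> {q powr (- real n + 1)..q powr (- real n)} then 1 - \<phi> (q ^ n * t)
      else 0)"

definition powers_rieffel :: "real \<Rightarrow> (real \<Rightarrow> real) \<Rightarrow> nat \<Rightarrow> (nat \<Rightarrow> fin_sum) set" where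
  "powers_rieffel q \<phi> n = (let A = crossed q in
     sph q (U [^]\<^bsub>A\<^esub> n \<otimes>\<^bsub>A\<^esub> Fn (pr_h q \<phi>) \<oplus>\<^bsub>A\<^esub> Fn (pr_f q \<phi> n)
            \<oplus>\<^bsub>A\<^esub> Fn (pr_h q \<phi>) \<otimes>\<^bsub>A\<^esub> (adj A U [^]\<^bsub>A\<^esub> n)))"

end

(*
  The equivalences are given by explicit partial isometries; no homotopy is needed.

  Write V = U^n, let C^2 + S^2 = 1 be the profile with C^2 = phi on [q,1], C = 0 below and C = 1
  above, and let c^2 + s^2 = 1 be the profile with c^2 = q^(-n(n-1)) t^(2n) / (1 + q^(-n(n-1)) t^(2n)).
  The column x = (c, V s) is isometric and P_n = x x^*; likewise x' = (V c, s) is isometric and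
  P_(-n) = x' x'^*. The element Z = alpha_q^n(C) - V S satisfies Z Z^* = 1 and Z^* Z = 1 - R_n,
  so y = (R_n, Z) is isometric with y y^* = diag(R_n, 1).

  None of x, x', y lies over the quantum sphere, because its coefficient of V does not vanish at both
  ends. The products v = y x^* and w = x' V^* Z do, since the offending coefficients cancel, and
  v v^* = diag(R_n, 1), v^* v = P_n, w w^* = P_(-n), w^* w = 1 - R_n.
*)

theory Submission
  imports Defs
begin

section \<open>Matrices over a *-ring\<close>

text \<open>The obstacle sits at the two fixed points of the scaling: in the sphere algebra only
  scalars survive at t = 0 and t = infinity. At infinity x, x', Z become (1, 0), (V, 0), 1; at 0
  they become (0, V), (0, 1), -V. So Z matches x up to scalars at both ends, whereas for x' a factor
  V^* is inserted first: V^* Z becomes V^* at infinity and -1 at 0. Z Z^* = 1 rests on alpha_q^n(C)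
  S = 0: where S does not vanish, t < 1, hence q^n t <= q and C(q^n t) = 0; this uses n >= 1. The
  middle coefficient of R_n is the difference of C^2 and alpha_q^n(C^2), and h = C S, which is why 1
  - Z^* Z is R_n. The two families of constants in the Bott matrices are one: moving V past a
  profile replaces t by q^n t, and q^(-n(n-1)) t^(2n) turns into q^(n(n+1)) t^(2n). All identities
  are verified on finite sums and carried over by \<open>sph\<close>. The norm enters through one
  estimate: every C*-seminorm is bounded by a sum of bounds for the coefficients, so that the
  supremum \<open>env_norm\<close> is a genuine one.\<close>

locale star_ring = ring A for A :: "('a, 'b) star_algebra_scheme" (structure) +
  assumes adj_closed [simp, intro]: "x \<in> carrier A \<Longrightarrow> adj A x \<in> carrier A"
    and adj_add: "\<lbrakk>x \<in> carrier A; y \<in> carrier A\<rbrakk> \<Longrightarrow> adj A (x \<oplus> y) = adj A x \<oplus> adj A y"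
    and adj_mult: "\<lbrakk>x \<in> carrier A; y \<in> carrier A\<rbrakk> \<Longrightarrow> adj A (x \<otimes> y) = adj A y \<otimes> adj A x"
    and adj_adj [simp]: "x \<in> carrier A \<Longrightarrow> adj A (adj A x) = x"
begin

lemma adj_zero [simp]: "adj A \<zero> = \<zero>"
proof -
  have "adj A \<zero> \<oplus> adj A \<zero> = adj A \<zero>"
    using adj_add[of \<zero> \<zero>] by simp
  then show ?thesis
    using add.l_cancel_one[of "adj A \<zero>" "adj A \<zero>"] by simp
qed

lemma adj_one [simp]: "adj A \<one> = \<one>"
proof -
  have "adj A (adj A \<one> \<otimes> \<one>) = adj A \<one> \<otimes> adj A (adj A \<one>)"
    by (rule adj_mult) auto
  then show ?thesis by simp
qed

lemma adj_minus: "x \<in> carrier A \<Longrightarrow> adj A (\<ominus> x) = \<ominus> adj A x"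
  by (rule minus_equality[symmetric]) (auto simp: adj_add[symmetric] l_neg)

lemma adj_diff:
  "x \<in> carrier A \<Longrightarrow> y \<in> carrier A \<Longrightarrow> adj A (x \<ominus> y) = adj A x \<ominus> adj A y"
  by (simp add: a_minus_def adj_add adj_minus)

lemma adj_finsum:
  assumes "finite I" "f \<in> I \<rightarrow> carrier A"
  shows "adj A (\<Oplus>i\<in>I. f i) = (\<Oplus>i\<in>I. adj A (f i))"
  using assms by (induction I rule: finite_induct) (auto simp: adj_add Pi_def)

text \<open>Cuts the inner index of a product of block matrices at the block boundary.\<close>

lemma finsum_add_split:
  fixes m n :: nat
  assumes "f \<in> {..<m + n} \<rightarrow> carrier A"
  shows "(\<Oplus>k\<in>{..<m + n}. f k) = (\<Oplus>k\<in>{..<m}. f k) \<oplus> (\<Oplus>k\<in>{..<n}. f (m + k))"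
  using assms
proof (induction n)
  case (Suc n)
  then have "f \<in> {..<m + n} \<rightarrow> carrier A" by auto
  moreover from Suc.prems have "f (m + n) \<in> carrier A" by auto
  moreover from Suc.prems have "f \<in> {..<m} \<rightarrow> carrier A" "(\<lambda>k. f (m + k)) \<in> {..<n} \<rightarrow> carrier A"
    by auto
  ultimately show ?case
    using Suc by (simp add: lessThan_Suc a_ac Pi_def)
qed (auto simp: Pi_def)

lemma mat_overD:
  assumes "M \<in> mat_over A m n"
  shows "dim_row M = m" "dim_col M = n" "M \<in> carrier_mat m n"
    "\<And>i j. \<lbrakk>i < m; j < n\<rbrakk> \<Longrightarrow> M $$ (i, j) \<in> carrier A"
  using assms by (auto simp: mat_over_def)

lemma mat_overI:
  assumes "dim_row M = m" "dim_col M = n"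
    "\<And>i j. \<lbrakk>i < m; j < n\<rbrakk> \<Longrightarrow> M $$ (i, j) \<in> carrier A"
  shows "M \<in> mat_over A m n"
  using assms by (auto simp: mat_over_def)

lemma dim_mmul [simp]: "dim_row (mmul A M N) = dim_row M" "dim_col (mmul A M N) = dim_col N"
  by (auto simp: mmul_def)

lemma index_mmul:
  "\<lbrakk>i < dim_row M; j < dim_col N\<rbrakk> \<Longrightarrow>
    mmul A M N $$ (i, j) = (\<Oplus>k\<in>{..<dim_col M}. M $$ (i, k) \<otimes> N $$ (k, j))"
  by (simp add: mmul_def)

lemma dim_madj [simp]: "dim_row (madj A M) = dim_col M" "dim_col (madj A M) = dim_row M"
  by (auto simp: madj_def)

lemma index_madj:
  "\<lbrakk>i < dim_col M; j < dim_row M\<rbrakk> \<Longrightarrow> madj A M $$ (i, j) = adj A (M $$ (j, i))"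
  by (simp add: madj_def)

lemma dim_dsum [simp]: "dim_row (dsum A M N) = dim_row M + dim_row N"
  "dim_col (dsum A M N) = dim_col M + dim_col N"
  by (auto simp: dsum_def)

lemma index_dsum:
  "\<lbrakk>i < dim_row M + dim_row N; j < dim_col M + dim_col N\<rbrakk> \<Longrightarrow>
    dsum A M N $$ (i, j) =
      (if i < dim_row M then if j < dim_col M then M $$ (i, j) else \<zero>
       else if j < dim_col M then \<zero> else N $$ (i - dim_row M, j - dim_col M))"
  by (auto simp: dsum_def)

text \<open>The anti-diagonal counterpart of \<open>dsum\<close>. With two projections as blocks it
  is the partial isometry that exchanges the summands of their direct sum.\<close>

definition asum :: "'a mat \<Rightarrow> 'a mat \<Rightarrow> 'a mat" where
  "asum M N = four_block_mat (mat (dim_row M) (dim_col N) (\<lambda>_. \<zero>)) M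
                N (mat (dim_row N) (dim_col M) (\<lambda>_. \<zero>))"

lemma dim_asum [simp]: "dim_row (asum M N) = dim_row M + dim_row N"
  "dim_col (asum M N) = dim_col N + dim_col M"
  by (auto simp: asum_def)

lemma index_asum:
  "\<lbrakk>i < dim_row M + dim_row N; j < dim_col N + dim_col M\<rbrakk> \<Longrightarrow>
    asum M N $$ (i, j) =
      (if i < dim_row M then if j < dim_col N then \<zero> else M $$ (i, j - dim_col N)
       else if j < dim_col N then N $$ (i - dim_row M, j) else \<zero>)"
  by (auto simp: asum_def)

lemma mmul_closed:
  "\<lbrakk>M \<in> mat_over A a b; N \<in> mat_over A b c\<rbrakk> \<Longrightarrow> mmul A M N \<in> mat_over A a c"
  by (rule mat_overI) (auto simp: index_mmul mat_overD intro!: finsum_closed)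

lemma madj_closed: "M \<in> mat_over A a b \<Longrightarrow> madj A M \<in> mat_over A b a"
  by (rule mat_overI) (auto simp: index_madj mat_overD)

lemma dsum_closed:
  "\<lbrakk>M \<in> mat_over A a b; N \<in> mat_over A c d\<rbrakk> \<Longrightarrow> dsum A M N \<in> mat_over A (a + c) (b + d)"
  by (rule mat_overI) (auto simp: index_dsum mat_overD)

lemma asum_closed:
  "\<lbrakk>M \<in> mat_over A a b; N \<in> mat_over A c d\<rbrakk> \<Longrightarrow> asum M N \<in> mat_over A (a + c) (d + b)"
  by (rule mat_overI) (auto simp: index_asum mat_overD)

lemma madj_madj: "M \<in> mat_over A a b \<Longrightarrow> madj A (madj A M) = M"
  by (rule eq_matI) (auto simp: index_madj mat_overD)

lemma madj_mmul:
  assumes "M \<in> mat_over A a b" "N \<in> mat_over A b c"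
  shows "madj A (mmul A M N) = mmul A (madj A N) (madj A M)"
  using assms
  by (intro eq_matI)
     (auto simp: index_madj index_mmul mat_overD adj_finsum adj_mult Pi_def intro!: finsum_cong')

lemma mmul_assoc:
  assumes M: "M \<in> mat_over A a b" and N: "N \<in> mat_over A b c" and K: "K \<in> mat_over A c d"
  shows "mmul A (mmul A M N) K = mmul A M (mmul A N K)"
proof (rule eq_matI)
  fix i j assume "i < dim_row (mmul A M (mmul A N K))" "j < dim_col (mmul A M (mmul A N K))"
  then have i: "i < a" and j: "j < d" using assms by (auto simp: mat_overD)
  note c = mat_overD(4)[OF M] mat_overD(4)[OF N] mat_overD(4)[OF K]
  note d = mat_overD(1-2)[OF M] mat_overD(1-2)[OF N] mat_overD(1-2)[OF K]
  have "mmul A (mmul A M N) K $$ (i, j) =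
      (\<Oplus>k\<in>{..<c}. (\<Oplus>l\<in>{..<b}. M $$ (i, l) \<otimes> N $$ (l, k)) \<otimes> K $$ (k, j))"
    using i j by (auto simp: index_mmul d c Pi_def intro!: finsum_cong')
  also have "\<dots> = (\<Oplus>k\<in>{..<c}. \<Oplus>l\<in>{..<b}. M $$ (i, l) \<otimes> (N $$ (l, k) \<otimes> K $$ (k, j)))"
    using i j by (intro finsum_cong') (auto simp: finsum_ldistr c Pi_def m_assoc intro!: finsum_cong' finsum_closed)
  also have "\<dots> = (\<Oplus>l\<in>{..<b}. \<Oplus>k\<in>{..<c}. M $$ (i, l) \<otimes> (N $$ (l, k) \<otimes> K $$ (k, j)))"
    using i j by (intro finsum_finsum_swap) (auto simp: c)
  also have "\<dots> = (\<Oplus>l\<in>{..<b}. M $$ (i, l) \<otimes> (\<Oplus>k\<in>{..<c}. N $$ (l, k) \<otimes> K $$ (k, j)))"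
    using i j by (intro finsum_cong') (auto simp: finsum_rdistr c Pi_def)
  also have "\<dots> = mmul A M (mmul A N K) $$ (i, j)"
    using i j by (auto simp: index_mmul d c Pi_def intro!: finsum_cong')
  finally show "mmul A (mmul A M N) K $$ (i, j) = mmul A M (mmul A N K) $$ (i, j)" .
qed (auto)

lemma madj_dsum:
  assumes "M \<in> mat_over A a b" "N \<in> mat_over A c d"
  shows "madj A (dsum A M N) = dsum A (madj A M) (madj A N)"
  using assms by (intro eq_matI) (auto simp: index_madj index_dsum mat_overD)

lemma madj_asum:
  assumes "M \<in> mat_over A a b" "N \<in> mat_over A c d"
  shows "madj A (asum M N) = asum (madj A N) (madj A M)"
  using assms by (intro eq_matI) (auto simp: index_madj index_asum mat_overD)

lemma mmul_dsum:
  assumes M: "M \<in> mat_over A a b" and N: "N \<in> mat_over A c d"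
    and M': "M' \<in> mat_over A b e" and N': "N' \<in> mat_over A d f"
  shows "mmul A (dsum A M N) (dsum A M' N') = dsum A (mmul A M M') (mmul A N N')"
proof (rule eq_matI)
  note c = mat_overD(4)[OF M] mat_overD(4)[OF N] mat_overD(4)[OF M'] mat_overD(4)[OF N']
  note d [simp] = mat_overD(1-2)[OF M] mat_overD(1-2)[OF N] mat_overD(1-2)[OF M'] mat_overD(1-2)[OF N']
  fix i j assume "i < dim_row (dsum A (mmul A M M') (mmul A N N'))"
    "j < dim_col (dsum A (mmul A M M') (mmul A N N'))"
  then have ij: "i < a + c" "j < e + f" by auto
  have "mmul A (dsum A M N) (dsum A M' N') $$ (i, j) =
     (\<Oplus>k\<in>{..<b + d}. dsum A M N $$ (i, k) \<otimes> dsum A M' N' $$ (k, j))"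
    using ij by (simp add: index_mmul)
  also have "\<dots> = (\<Oplus>k\<in>{..<b}. dsum A M N $$ (i, k) \<otimes> dsum A M' N' $$ (k, j)) \<oplus>
      (\<Oplus>k\<in>{..<d}. dsum A M N $$ (i, b + k) \<otimes> dsum A M' N' $$ (b + k, j))"
    using ij by (intro finsum_add_split) (auto simp: index_dsum c)
  \<comment> \<open>On each half of the inner index one factor is an off-diagonal zero, unless (i,
    j) lies in the corresponding diagonal block.\<close>
  also have "(\<Oplus>k\<in>{..<b}. dsum A M N $$ (i, k) \<otimes> dsum A M' N' $$ (k, j)) =
      (if i < a \<and> j < e then \<Oplus>k\<in>{..<b}. M $$ (i, k) \<otimes> M' $$ (k, j) else \<zero>)"
    using ij by (auto simp: index_dsum c intro!: finsum_zero' finsum_cong')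
  also have "(\<Oplus>k\<in>{..<d}. dsum A M N $$ (i, b + k) \<otimes> dsum A M' N' $$ (b + k, j)) =
      (if i \<ge> a \<and> j \<ge> e then \<Oplus>k\<in>{..<d}. N $$ (i - a, k) \<otimes> N' $$ (k, j - e) else \<zero>)"
    using ij by (auto simp: index_dsum c intro!: finsum_zero' finsum_cong')
  finally show "mmul A (dsum A M N) (dsum A M' N') $$ (i, j) = dsum A (mmul A M M') (mmul A N N') $$ (i, j)"
    using ij by (auto simp: index_dsum index_mmul c intro!: r_zero l_zero finsum_closed)
qed auto

lemma mmul_asum:
  assumes M: "M \<in> mat_over A a b" and N: "N \<in> mat_over A c d"
    and M': "M' \<in> mat_over A b e" and N': "N' \<in> mat_over A d f"
  shows "mmul A (asum M N) (asum N' M') = dsum A (mmul A M M') (mmul A N N')"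
proof (rule eq_matI)
  note c = mat_overD(4)[OF M] mat_overD(4)[OF N] mat_overD(4)[OF M'] mat_overD(4)[OF N']
  note d [simp] = mat_overD(1-2)[OF M] mat_overD(1-2)[OF N] mat_overD(1-2)[OF M'] mat_overD(1-2)[OF N']
  fix i j assume "i < dim_row (dsum A (mmul A M M') (mmul A N N'))"
    "j < dim_col (dsum A (mmul A M M') (mmul A N N'))"
  then have ij: "i < a + c" "j < e + f" by auto
  have "mmul A (asum M N) (asum N' M') $$ (i, j) =
     (\<Oplus>k\<in>{..<d + b}. asum M N $$ (i, k) \<otimes> asum N' M' $$ (k, j))"
    using ij by (simp add: index_mmul)
  \<comment> \<open>In \<open>asum\<close> the columns of N precede those of M, so the inner index
    is cut at \<open>d\<close> and not at \<open>b\<close>.\<close>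
  also have "\<dots> = (\<Oplus>k\<in>{..<d}. asum M N $$ (i, k) \<otimes> asum N' M' $$ (k, j)) \<oplus>
      (\<Oplus>k\<in>{..<b}. asum M N $$ (i, d + k) \<otimes> asum N' M' $$ (d + k, j))"
    using ij by (intro finsum_add_split) (auto simp: index_asum c)
  also have "(\<Oplus>k\<in>{..<d}. asum M N $$ (i, k) \<otimes> asum N' M' $$ (k, j)) =
      (if i \<ge> a \<and> j \<ge> e then \<Oplus>k\<in>{..<d}. N $$ (i - a, k) \<otimes> N' $$ (k, j - e) else \<zero>)"
    using ij by (auto simp: index_asum c intro!: finsum_zero' finsum_cong')
  also have "(\<Oplus>k\<in>{..<b}. asum M N $$ (i, d + k) \<otimes> asum N' M' $$ (d + k, j)) =
      (if i < a \<and> j < e then \<Oplus>k\<in>{..<b}. M $$ (i, k) \<otimes> M' $$ (k, j) else \<zero>)"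
    using ij by (auto simp: index_asum c intro!: finsum_zero' finsum_cong')
  finally show "mmul A (asum M N) (asum N' M') $$ (i, j) = dsum A (mmul A M M') (mmul A N N') $$ (i, j)"
    using ij by (auto simp: index_dsum index_mmul c intro!: r_zero l_zero finsum_closed)
qed auto

text \<open>A true equality of matrices of any sizes, since both sides show the same three diagonal
  blocks; it can therefore rewrite inside equivalences.\<close>

lemma dsum_assoc: "dsum A (dsum A M N) K = dsum A M (dsum A N K)"
proof (rule eq_matI)
  fix i j assume "i < dim_row (dsum A M (dsum A N K))" "j < dim_col (dsum A M (dsum A N K))"
  \<comment> \<open>Writing an index as offset plus remainder removes the truncated subtractions in
    \<open>index_dsum\<close>.\<close>
  moreover have three: "k < a \<or> (\<exists>l. k = a + l \<and> l < b) \<or> (\<exists>l. k = a + b + l)" for k a b :: nat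
    by presburger
  ultimately show "dsum A (dsum A M N) K $$ (i, j) = dsum A M (dsum A N K) $$ (i, j)"
    using three[of i "dim_row M" "dim_row N"] three[of j "dim_col M" "dim_col N"]
    by (elim disjE exE conjE) (simp_all add: index_dsum)
qed (simp_all add: ac_simps)

section \<open>Murray--von Neumann equivalence\<close>

lemma projsD:
  assumes "p \<in> projs A"
  shows "p \<in> mat_over A (dim_row p) (dim_row p)" "madj A p = p" "mmul A p p = p"
    "dim_col p = dim_row p"
  using assms by (auto simp: projs_def mat_over_def)

lemma zero_proj_projs: "zero_proj A \<in> projs A"
  by (auto simp: projs_def zero_proj_def mat_over_def madj_def mmul_def intro!: eq_matI finsum_zero')

lemma dsum_projs:
  assumes "p \<in> projs A" "r \<in> projs A"
  shows "dsum A p r \<in> projs A"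
proof -
  note p = projsD(1)[OF assms(1)] and r = projsD(1)[OF assms(2)]
  show ?thesis
    using dsum_closed[OF p r] madj_dsum[OF p r] mmul_dsum[OF p r p r] assms
    by (simp add: projs_def)
qed

lemma mvn_refl: "p \<in> projs A \<Longrightarrow> mvn_equiv A p p"
  unfolding mvn_equiv_def using projsD[of p] by (intro bexI[of _ p]) auto

lemma mvn_sym:
  assumes "mvn_equiv A p r"
  shows "mvn_equiv A r p"
proof -
  obtain v where v: "v \<in> mat_over A (dim_row p) (dim_row r)"
    "mmul A v (madj A v) = p" "mmul A (madj A v) v = r"
    using assms by (auto simp: mvn_equiv_def)
  then show ?thesis
    unfolding mvn_equiv_def
    by (intro bexI[of _ "madj A v"]) (auto simp: madj_madj[OF v(1)] madj_closed)
qed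

text \<open>The witness is the product v w. With w w^* = r = v^* v one gets v r v^* = p p and w^* r
  w = s s, which is where p and s must be idempotent.\<close>

lemma mvn_trans:
  assumes "mvn_equiv A p r" "mvn_equiv A r s" "p \<in> projs A" "s \<in> projs A"
  shows "mvn_equiv A p s"
proof -
  let ?a = "dim_row p" and ?b = "dim_row r" and ?c = "dim_row s"
  obtain v where v: "v \<in> mat_over A ?a ?b" "mmul A v (madj A v) = p" "mmul A (madj A v) v = r"
    using assms by (auto simp: mvn_equiv_def)
  obtain w where w: "w \<in> mat_over A ?b ?c" "mmul A w (madj A w) = r" "mmul A (madj A w) w = s"
    using assms by (auto simp: mvn_equiv_def)
  note v' = madj_closed[OF v(1)] and w' = madj_closed[OF w(1)]
  note closed = v(1) w(1) v' w'
  have "mmul A (mmul A v w) (madj A (mmul A v w)) = mmul A v (mmul A (mmul A w (madj A w)) (madj A v))"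
    by (simp add: madj_mmul[OF v(1) w(1)] mmul_assoc[OF v(1) w(1) mmul_closed[OF w' v']]
        mmul_assoc[OF w(1) w' v'])
  also have "\<dots> = mmul A (mmul A v (madj A v)) (mmul A v (madj A v))"
    using mmul_assoc[OF v' v(1) v'] mmul_assoc[OF v(1) v' mmul_closed[OF v(1) v']] v w by simp
  also have "\<dots> = p" using v projsD[OF assms(3)] by simp
  finally have 1: "mmul A (mmul A v w) (madj A (mmul A v w)) = p" .
  have "mmul A (madj A (mmul A v w)) (mmul A v w) = mmul A (madj A w) (mmul A (mmul A (madj A v) v) w)"
    by (simp add: madj_mmul[OF v(1) w(1)] mmul_assoc[OF w' v' mmul_closed[OF v(1) w(1)]]
        mmul_assoc[OF v' v(1) w(1)])
  also have "\<dots> = mmul A (mmul A (madj A w) w) (mmul A (madj A w) w)"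
    using mmul_assoc[OF w(1) w' w(1)] mmul_assoc[OF w' w(1) mmul_closed[OF w' w(1)]] v w by simp
  also have "\<dots> = s" using w projsD[OF assms(4)] by simp
  finally show ?thesis
    unfolding mvn_equiv_def using 1 mmul_closed[OF v(1) w(1)] by blast
qed

lemma mvn_dsum:
  assumes "mvn_equiv A p p'" "mvn_equiv A r r'"
  shows "mvn_equiv A (dsum A p r) (dsum A p' r')"
proof -
  obtain v where v: "v \<in> mat_over A (dim_row p) (dim_row p')"
    "mmul A v (madj A v) = p" "mmul A (madj A v) v = p'"
    using assms by (auto simp: mvn_equiv_def)
  obtain w where w: "w \<in> mat_over A (dim_row r) (dim_row r')"
    "mmul A w (madj A w) = r" "mmul A (madj A w) w = r'"
    using assms by (auto simp: mvn_equiv_def)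
  note v' = madj_closed[OF v(1)] and w' = madj_closed[OF w(1)]
  show ?thesis
    unfolding mvn_equiv_def
    using v w dsum_closed[OF v(1) w(1)] madj_dsum[OF v(1) w(1)]
      mmul_dsum[OF v(1) w(1) v' w'] mmul_dsum[OF v' w' v(1) w(1)]
    by (intro bexI[of _ "dsum A v w"]) auto
qed

lemma mvn_dsum_comm:
  assumes "p \<in> projs A" "r \<in> projs A"
  shows "mvn_equiv A (dsum A p r) (dsum A r p)"
proof -
  note p = projsD(1)[OF assms(1)] and r = projsD(1)[OF assms(2)]
  show ?thesis
    unfolding mvn_equiv_def
    using asum_closed[OF p r] madj_asum[OF p r] mmul_asum[OF p r p r] mmul_asum[OF r p r p]
      projsD[OF assms(1)] projsD[OF assms(2)]
    by (intro bexI[of _ "asum p r"]) auto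
qed

text \<open>A rectangular zero matrix is the witness. This absorbs the extra copy of
  \<open>zero_proj\<close> that appears when two differences [p] - [0] and [r] - [0] are
  added.\<close>

lemma mvn_zero_dsum_zero: "mvn_equiv A (zero_proj A) (dsum A (zero_proj A) (zero_proj A))"
  unfolding mvn_equiv_def
  by (intro bexI[of _ "mat 1 2 (\<lambda>_. \<zero>)"])
     (auto simp: zero_proj_def mat_over_def madj_def mmul_def dsum_def intro!: eq_matI finsum_zero')

text \<open>
  The monoid of Murray--von Neumann classes, with the sum defined on arbitrary sets so that
  associativity and commutativity hold without side conditions and can be used for rewriting.
\<close>

definition mvn_class :: "'a mat \<Rightarrow> 'a mat set" where
  "mvn_class p = {u \<in> projs A. mvn_equiv A u p}"

definition class_sum :: "'a mat set \<Rightarrow> 'a mat set \<Rightarrow> 'a mat set" where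
  "class_sum X Y = {u \<in> projs A. \<exists>p\<in>X \<inter> projs A. \<exists>r\<in>Y \<inter> projs A. mvn_equiv A u (dsum A p r)}"

lemma mvn_class_eq_iff:
  "p \<in> projs A \<Longrightarrow> r \<in> projs A \<Longrightarrow> mvn_class p = mvn_class r \<longleftrightarrow> mvn_equiv A p r"
  unfolding mvn_class_def by (blast intro: mvn_refl mvn_sym mvn_trans)

lemma mvn_class_dsum:
  assumes "p \<in> projs A" "r \<in> projs A"
  shows "mvn_class (dsum A p r) = class_sum (mvn_class p) (mvn_class r)"
proof (intro equalityI subsetI)
  fix u assume "u \<in> mvn_class (dsum A p r)"
  then show "u \<in> class_sum (mvn_class p) (mvn_class r)"
    using assms unfolding class_sum_def mvn_class_def by (blast intro: mvn_refl)
next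
  fix u assume "u \<in> class_sum (mvn_class p) (mvn_class r)"
  then obtain p' r' where *: "u \<in> projs A" "p' \<in> projs A" "r' \<in> projs A" "mvn_equiv A p' p"
    "mvn_equiv A r' r" "mvn_equiv A u (dsum A p' r')"
    unfolding class_sum_def mvn_class_def by blast
  then show "u \<in> mvn_class (dsum A p r)"
    using mvn_trans[OF *(6) mvn_dsum[OF *(4,5)] *(1)] assms
    unfolding mvn_class_def by (blast intro: dsum_projs)
qed

lemma class_sum_comm: "class_sum X Y = class_sum Y X"
  unfolding class_sum_def by (blast intro: mvn_dsum_comm mvn_trans dsum_projs)

text \<open>Both bracketings are brought to one normal form, quantified over triples of projections,
  where \<open>dsum_assoc\<close> applies literally.\<close>

lemma class_sum_assoc: "class_sum (class_sum X Y) Z = class_sum X (class_sum Y Z)"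
proof -
  \<comment> \<open>Kept general in the three sets, because it is used again with the arguments
    permuted cyclically.\<close>
  have 1: "class_sum (class_sum X Y) Z = {u \<in> projs A. \<exists>p\<in>X \<inter> projs A. \<exists>r\<in>Y \<inter> projs A.
    \<exists>s\<in>Z \<inter> projs A. mvn_equiv A u (dsum A p (dsum A r s))}" (is "?L = ?M") for X Y Z
  proof (intro equalityI subsetI)
    fix u assume "u \<in> ?L"
    then obtain w s p r where *: "u \<in> projs A" "w \<in> projs A" "s \<in> Z \<inter> projs A" "p \<in> X \<inter> projs A"
       "r \<in> Y \<inter> projs A" "mvn_equiv A w (dsum A p r)" "mvn_equiv A u (dsum A w s)"
      unfolding class_sum_def by blast
    then have "mvn_equiv A (dsum A w s) (dsum A (dsum A p r) s)"
      by (intro mvn_dsum mvn_refl) auto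
    with * have "mvn_equiv A u (dsum A p (dsum A r s))"
      unfolding dsum_assoc[symmetric] by (blast intro: mvn_trans dsum_projs)
    with * show "u \<in> ?M" by blast
  next
    fix u assume "u \<in> ?M"
    then obtain s p r where *: "u \<in> projs A" "s \<in> Z \<inter> projs A" "p \<in> X \<inter> projs A"
       "r \<in> Y \<inter> projs A" "mvn_equiv A u (dsum A (dsum A p r) s)"
      unfolding dsum_assoc by blast
    moreover from * have "dsum A p r \<in> class_sum X Y \<inter> projs A"
      unfolding class_sum_def by (blast intro: mvn_refl dsum_projs)
    ultimately show "u \<in> ?L" unfolding class_sum_def[of "class_sum X Y"] by blast
  qed
  \<comment> \<open>One commutation turns the right-nested sum into a left-nested one, at the price
    of a cyclic shift of the summands that is undone below.\<close>
  have "class_sum X (class_sum Y Z) = class_sum (class_sum Y Z) X"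
    by (rule class_sum_comm)
  also have "\<dots> = {u \<in> projs A. \<exists>p\<in>X \<inter> projs A. \<exists>r\<in>Y \<inter> projs A.
    \<exists>s\<in>Z \<inter> projs A. mvn_equiv A u (dsum A r (dsum A s p))}"
    unfolding 1 by blast
  also have "\<dots> = {u \<in> projs A. \<exists>p\<in>X \<inter> projs A. \<exists>r\<in>Y \<inter> projs A.
    \<exists>s\<in>Z \<inter> projs A. mvn_equiv A u (dsum A p (dsum A r s))}"
  proof -
    have "mvn_equiv A u (dsum A r (dsum A s p)) \<longleftrightarrow> mvn_equiv A u (dsum A p (dsum A r s))"
      if "u \<in> projs A" "p \<in> projs A" "r \<in> projs A" "s \<in> projs A" for u p r s
      using that mvn_dsum_comm[of "dsum A r s" p] unfolding dsum_assoc
      by (blast intro: mvn_trans mvn_sym dsum_projs)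
    then show ?thesis by blast
  qed
  finally show ?thesis unfolding 1 by simp
qed

lemma class_sum_left_comm: "class_sum X (class_sum Y Z) = class_sum Y (class_sum X Z)"
  by (metis class_sum_assoc class_sum_comm)

lemmas class_sum_ac = class_sum_assoc class_sum_comm class_sum_left_comm

section \<open>The group K0\<close>

text \<open>Replaces equivalence of matrices by equality in the commutative semigroup of classes, so
  that later proofs become rewriting with \<open>class_sum_ac\<close>.\<close>

lemma K0_rel_iff:
  "((p, r), (p', r')) \<in> K0_rel A \<longleftrightarrow>
     p \<in> projs A \<and> r \<in> projs A \<and> p' \<in> projs A \<and> r' \<in> projs A \<and>
     (\<exists>s \<in> projs A. class_sum (mvn_class p) (class_sum (mvn_class r') (mvn_class s)) =
                     class_sum (mvn_class p') (class_sum (mvn_class r) (mvn_class s)))"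
  unfolding K0_rel_def
  by (auto simp: mvn_class_eq_iff[symmetric] dsum_projs mvn_class_dsum class_sum_assoc) blast+

lemma equiv_K0_rel: "equiv (projs A \<times> projs A) (K0_rel A)"
proof (rule equivI)
  show "K0_rel A \<subseteq> (projs A \<times> projs A) \<times> (projs A \<times> projs A)"
    by (auto simp: K0_rel_def)
  show "refl_on (projs A \<times> projs A) (K0_rel A)"
    using zero_proj_projs by (auto simp: K0_rel_iff intro!: refl_onI)
  show "sym (K0_rel A)"
    by (rule symI) (clarsimp simp: K0_rel_iff, metis)
  show "trans (K0_rel A)"
  proof (rule transI, clarify)
    fix p r p' r' p'' r''
    assume "((p, r), (p', r')) \<in> K0_rel A" and "((p', r'), (p'', r'')) \<in> K0_rel A"
    then obtain s s' where P: "p \<in> projs A" "r \<in> projs A" "p' \<in> projs A" "r' \<in> projs A"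
      "p'' \<in> projs A" "r'' \<in> projs A" "s \<in> projs A" "s' \<in> projs A"
      and 1: "class_sum (mvn_class p) (class_sum (mvn_class r') (mvn_class s)) =
                     class_sum (mvn_class p') (class_sum (mvn_class r) (mvn_class s))"
      and 2: "class_sum (mvn_class p') (class_sum (mvn_class r'') (mvn_class s')) =
                     class_sum (mvn_class p'') (class_sum (mvn_class r') (mvn_class s'))"
      unfolding K0_rel_iff by blast
    \<comment> \<open>Adding the two equations gives the desired one with r', s, p' and s' left over
      on both sides; this surplus is the new stabilizing summand.\<close>
    define t where "t = dsum A (dsum A r' s) (dsum A p' s')"
    have t: "t \<in> projs A" unfolding t_def using P by (simp add: dsum_projs)
    have "class_sum (mvn_class p) (class_sum (mvn_class r'') (mvn_class t)) =
      class_sum (class_sum (mvn_class p) (class_sum (mvn_class r') (mvn_class s)))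
        (class_sum (mvn_class p') (class_sum (mvn_class r'') (mvn_class s')))"
      unfolding t_def using P by (simp add: mvn_class_dsum dsum_projs class_sum_ac)
    also have "\<dots> = class_sum (mvn_class p'') (class_sum (mvn_class r) (mvn_class t))"
      unfolding 1 2 t_def using P by (simp add: mvn_class_dsum dsum_projs class_sum_ac)
    finally show "((p, r), (p'', r'')) \<in> K0_rel A"
      unfolding K0_rel_iff using P t by blast
  qed
qed

lemma K0_rel_dsum:
  assumes "((p, r), (p', r')) \<in> K0_rel A" "((x, y), (x', y')) \<in> K0_rel A"
  shows "((dsum A p x, dsum A r y), (dsum A p' x', dsum A r' y')) \<in> K0_rel A"
proof -
  obtain s t where P: "p \<in> projs A" "r \<in> projs A" "p' \<in> projs A" "r' \<in> projs A"
      "x \<in> projs A" "y \<in> projs A" "x' \<in> projs A" "y' \<in> projs A" "s \<in> projs A" "t \<in> projs A"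
      and 1: "class_sum (mvn_class p) (class_sum (mvn_class r') (mvn_class s)) =
                     class_sum (mvn_class p') (class_sum (mvn_class r) (mvn_class s))"
      and 2: "class_sum (mvn_class x) (class_sum (mvn_class y') (mvn_class t)) =
                     class_sum (mvn_class x') (class_sum (mvn_class y) (mvn_class t))"
    using assms unfolding K0_rel_iff by blast
  have "class_sum (mvn_class (dsum A p x)) (class_sum (mvn_class (dsum A r' y')) (mvn_class (dsum A s t))) =
     class_sum (class_sum (mvn_class p) (class_sum (mvn_class r') (mvn_class s)))
       (class_sum (mvn_class x) (class_sum (mvn_class y') (mvn_class t)))"
    using P by (simp add: mvn_class_dsum dsum_projs class_sum_ac)
  also have "\<dots> = class_sum (mvn_class (dsum A p' x')) (class_sum (mvn_class (dsum A r y)) (mvn_class (dsum A s t)))"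
    unfolding 1 2 using P by (simp add: mvn_class_dsum dsum_projs class_sum_ac)
  finally show ?thesis
    unfolding K0_rel_iff using P by (blast intro: dsum_projs)
qed

lemma K0_class_eqI:
  assumes "mvn_equiv A p r" "p \<in> projs A" "r \<in> projs A"
  shows "K0_class A p = K0_class A r"
proof -
  have "mvn_class p = mvn_class r" using assms by (simp add: mvn_class_eq_iff)
  then have "((p, zero_proj A), (r, zero_proj A)) \<in> K0_rel A"
    using assms zero_proj_projs unfolding K0_rel_iff by auto
  then show ?thesis
    unfolding K0_class_def by (rule equiv_class_eq[OF equiv_K0_rel])
qed

text \<open>The product in \<open>K0\<close> is a union over all pairs of representatives.
  \<open>E\<close> shows that all of them give the same class, and \<open>self\<close> supplies one
  pair, so the union is not empty.\<close>

lemma K0_mult_class: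
  assumes "p \<in> projs A" "r \<in> projs A"
  shows "K0_class A p \<otimes>\<^bsub>K0 A\<^esub> K0_class A r = K0_class A (dsum A p r)"
proof -
  let ?z = "zero_proj A"
  note z = zero_proj_projs
  have z2: "class_sum (mvn_class ?z) (mvn_class ?z) = mvn_class ?z"
    using z mvn_zero_dsum_zero by (simp add: mvn_class_dsum[symmetric] mvn_class_eq_iff dsum_projs mvn_sym)
  have E: "K0_rel A `` {(dsum A u u', dsum A w w')} = K0_class A (dsum A p r)"
    if "(u, w) \<in> K0_class A p" "(u', w') \<in> K0_class A r" for u w u' w'
  proof -
    have "((dsum A p r, dsum A ?z ?z), (dsum A u u', dsum A w w')) \<in> K0_rel A"
      using that by (intro K0_rel_dsum) (auto simp: K0_class_def)
    \<comment> \<open>The subtracted parts add up to 0 + 0, which \<open>z2\<close> collapses to the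
      single \<open>zero_proj\<close> of a \<open>K0_class\<close>.\<close>
    moreover have "((dsum A p r, ?z), (dsum A p r, dsum A ?z ?z)) \<in> K0_rel A"
      unfolding K0_rel_iff using assms z by (auto simp: mvn_class_dsum dsum_projs z2)
    ultimately have "((dsum A p r, ?z), (dsum A u u', dsum A w w')) \<in> K0_rel A"
      using equiv_K0_rel by (meson equivE transE)
    then show ?thesis unfolding K0_class_def by (metis equiv_class_eq[OF equiv_K0_rel])
  qed
  have self: "(u, ?z) \<in> K0_class A u" if "u \<in> projs A" for u
    unfolding K0_class_def using that z equiv_K0_rel by (auto dest: equiv_class_self)
  show ?thesis
  proof (intro equalityI subsetI)
    fix u assume "u \<in> K0_class A p \<otimes>\<^bsub>K0 A\<^esub> K0_class A r"
    then obtain a b a' b' where "(a, b) \<in> K0_class A p" "(a', b') \<in> K0_class A r"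
      "u \<in> K0_rel A `` {(dsum A a a', dsum A b b')}"
      by (auto simp: K0_def)
    then show "u \<in> K0_class A (dsum A p r)" using E by blast
  next
    fix u assume "u \<in> K0_class A (dsum A p r)"
    then show "u \<in> K0_class A p \<otimes>\<^bsub>K0 A\<^esub> K0_class A r"
      using E[OF self[OF assms(1)] self[OF assms(2)]] self[OF assms(1)] self[OF assms(2)]
      by (auto simp: K0_def)
  qed
qed

end

section \<open>Completion with respect to the universal C*-seminorm\<close>

text \<open>Keeps the set of C*-seminorms nonempty, which the supremum in \<open>env_norm\<close>
  requires, and makes that supremum nonnegative.\<close>

lemma cstar_seminorm_zero: "cstar_seminorm A (\<lambda>_. 0)"
  by (simp add: cstar_seminorm_def)

text \<open>Two instances of the scalar action are recorded: with homogeneity they give p 0 = 0 and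
  p (-x) = p x for a C*-seminorm p. Pointwise boundedness makes the real supremum an actual least
  upper bound.\<close>

locale bounded_star_algebra = star_ring A for A :: "('a, 'b) star_algebra_scheme" (structure) +
  assumes smult_zero: "0 \<odot> \<zero> = \<zero>"
    and smult_minus_one: "x \<in> carrier A \<Longrightarrow> (- 1) \<odot> x = \<ominus> x"
    and seminorms_bounded: "x \<in> carrier A \<Longrightarrow> \<exists>B. \<forall>p. cstar_seminorm A p \<longrightarrow> p x \<le> B"
begin

abbreviation N :: "'a \<Rightarrow> real" where "N \<equiv> env_norm A"

lemma seminorm_le_N: "x \<in> carrier A \<Longrightarrow> cstar_seminorm A p \<Longrightarrow> p x \<le> N x"
  unfolding env_norm_def using seminorms_bounded
  by (intro cSUP_upper) (auto simp: bdd_above_def)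

lemma N_le: "(\<And>p. cstar_seminorm A p \<Longrightarrow> p x \<le> B) \<Longrightarrow> N x \<le> B"
  unfolding env_norm_def using cstar_seminorm_zero by (intro cSUP_least) auto

lemma N_nonneg: "x \<in> carrier A \<Longrightarrow> 0 \<le> N x"
  using seminorm_le_N[OF _ cstar_seminorm_zero] by simp

lemma N_zero: "N \<zero> = 0"
proof -
  have "p \<zero> = 0" if "cstar_seminorm A p" for p
  proof -
    have "p (0 \<odot> \<zero>) = cmod 0 * p \<zero>" using that unfolding cstar_seminorm_def by blast
    then show ?thesis by (simp add: smult_zero)
  qed
  then have "N \<zero> \<le> 0" by (intro N_le eq_refl)
  then show ?thesis using N_nonneg[of \<zero>] by simp
qed

lemma N_add:
  assumes "x \<in> carrier A" "y \<in> carrier A"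
  shows "N (x \<oplus> y) \<le> N x + N y"
proof (rule N_le)
  fix p assume p: "cstar_seminorm A p"
  then have "p (x \<oplus> y) \<le> p x + p y"
    using assms by (simp add: cstar_seminorm_def)
  then show "p (x \<oplus> y) \<le> N x + N y"
    using seminorm_le_N[OF _ p] assms by (smt (verit))
qed

lemma N_mult:
  assumes "x \<in> carrier A" "y \<in> carrier A"
  shows "N (x \<otimes> y) \<le> N x * N y"
proof (rule N_le)
  fix p assume p: "cstar_seminorm A p"
  then have "p (x \<otimes> y) \<le> p x * p y" "0 \<le> p y"
    using assms by (simp_all add: cstar_seminorm_def)
  moreover have "p x * p y \<le> N x * N y"
    using \<open>0 \<le> p y\<close> assms by (intro mult_mono seminorm_le_N[OF _ p] N_nonneg)
  ultimately show "p (x \<otimes> y) \<le> N x * N y" by simp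
qed

lemma N_uminus: "x \<in> carrier A \<Longrightarrow> N (\<ominus> x) = N x"
  unfolding env_norm_def
  by (intro SUP_cong refl) (simp add: smult_minus_one[symmetric] cstar_seminorm_def)

text \<open>The C*-identity and submultiplicativity bound the square of p y by p (adj y) times p y;
  cancelling gives one inequality, and the same for adj y gives the other.\<close>

lemma cstar_seminorm_adj:
  assumes p: "cstar_seminorm A p" and x: "x \<in> carrier A"
  shows "p (adj A x) = p x"
proof -
  have le: "p y \<le> p (adj A y)" if "y \<in> carrier A" for y
  proof -
    have "(p y)\<^sup>2 \<le> p (adj A y) * p y" "0 \<le> p y" "0 \<le> p (adj A y)"
      using p that by (auto simp: cstar_seminorm_def) (metis adj_closed)
    then show ?thesis by (cases "p y = 0") (auto simp: power2_eq_square)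
  qed
  show ?thesis using le[OF x] le[of "adj A x"] x by simp
qed

lemma N_adj: "x \<in> carrier A \<Longrightarrow> N (adj A x) = N x"
  unfolding env_norm_def by (intro SUP_cong refl) (simp add: cstar_seminorm_adj)

lemma N_diff_commute: "x \<in> carrier A \<Longrightarrow> y \<in> carrier A \<Longrightarrow> N (x \<ominus> y) = N (y \<ominus> x)"
  using N_uminus[of "x \<ominus> y"] by (simp add: a_minus_def minus_add a_comm)

lemma N_diff_triangle:
  assumes "x \<in> carrier A" "y \<in> carrier A" "z \<in> carrier A"
  shows "N (x \<ominus> z) \<le> N (x \<ominus> y) + N (y \<ominus> z)"
proof -
  have "x \<ominus> z = (x \<ominus> y) \<oplus> (y \<ominus> z)"
    using assms by (simp add: a_minus_def a_ac r_neg2)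
  then show ?thesis using N_add[of "x \<ominus> y" "y \<ominus> z"] assms by simp
qed

lemma N_diff_abs:
  assumes "x \<in> carrier A" "y \<in> carrier A"
  shows "\<bar>N x - N y\<bar> \<le> N (x \<ominus> y)"
proof -
  have "x \<ominus> \<zero> = x" "y \<ominus> \<zero> = y" using assms by (simp_all add: a_minus_def)
  then show ?thesis
    using N_diff_triangle[of x y \<zero>] N_diff_triangle[of y x \<zero>] N_diff_commute[of x y] assms by auto
qed

lemma N_add_diff:
  assumes "x \<in> carrier A" "y \<in> carrier A" "x' \<in> carrier A" "y' \<in> carrier A"
  shows "N ((x \<oplus> y) \<ominus> (x' \<oplus> y')) \<le> N (x \<ominus> x') + N (y \<ominus> y')"
proof -
  have "(x \<oplus> y) \<ominus> (x' \<oplus> y') = (x \<ominus> x') \<oplus> (y \<ominus> y')"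
    using assms by (simp add: a_minus_def minus_add a_ac)
  then show ?thesis using N_add[of "x \<ominus> x'" "y \<ominus> y'"] assms by simp
qed

lemma N_mult_diff:
  assumes "x \<in> carrier A" "y \<in> carrier A" "x' \<in> carrier A" "y' \<in> carrier A"
  shows "N ((x \<otimes> y) \<ominus> (x' \<otimes> y')) \<le> N (x \<ominus> x') * N y + N x' * N (y \<ominus> y')"
proof -
  have "(x \<otimes> y) \<ominus> (x' \<otimes> y') = (x \<ominus> x') \<otimes> y \<oplus> x' \<otimes> (y \<ominus> y')"
    using assms by (simp add: a_minus_def l_distr r_distr l_minus r_minus a_ac r_neg2)
  then show ?thesis
    using N_add[of "(x \<ominus> x') \<otimes> y" "x' \<otimes> (y \<ominus> y')"] N_mult[of "x \<ominus> x'" y] N_mult[of x' "y \<ominus> y'"]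
      assms by simp
qed

lemma N_adj_diff:
  "x \<in> carrier A \<Longrightarrow> y \<in> carrier A \<Longrightarrow> N (adj A x \<ominus> adj A y) = N (x \<ominus> y)"
  by (simp add: adj_diff[symmetric] N_adj)

section \<open>Cauchy sequences and the operations on their classes\<close>

abbreviation "C \<equiv> env_cauchy A"

definition cls :: "(nat \<Rightarrow> 'a) \<Rightarrow> (nat \<Rightarrow> 'a) set" where "cls s = env_rel A `` {s}"

lemma C_closed [simp]: "s \<in> C \<Longrightarrow> s n \<in> carrier A"
  by (auto simp: env_cauchy_def)

lemma C_D: "s \<in> C \<Longrightarrow> 0 < e \<Longrightarrow> \<exists>M. \<forall>m\<ge>M. \<forall>n\<ge>M. N (s m \<ominus> s n) < e"
  by (auto simp: env_cauchy_def)

lemma C_I: "(\<And>n. s n \<in> carrier A) \<Longrightarrow>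
    (\<And>e. 0 < e \<Longrightarrow> \<exists>M. \<forall>m\<ge>M. \<forall>n\<ge>M. N (s m \<ominus> s n) < e) \<Longrightarrow> s \<in> C"
  by (auto simp: env_cauchy_def)

lemma C_const [simp]: "x \<in> carrier A \<Longrightarrow> (\<lambda>_. x) \<in> C"
  by (rule C_I) (auto simp: a_minus_def r_neg N_zero)

lemma C_bounded:
  assumes "s \<in> C"
  obtains B where "B > 0" "\<And>n. N (s n) \<le> B"
proof -
  obtain M where M: "\<And>m n. m \<ge> M \<Longrightarrow> n \<ge> M \<Longrightarrow> N (s m \<ominus> s n) < 1"
    using C_D[OF assms, of 1] by auto
  \<comment> \<open>From index M on the terms stay within 1 of the norm of \<open>s M\<close>, and
    the finite sum covers the earlier ones. The summand 1 also makes B positive, so that later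
    estimates may divide by it.\<close>
  define B where "B = N (s M) + 1 + (\<Sum>m<M. N (s m))"
  have "N (s n) \<le> B" for n
  proof (cases "n < M")
    case True
    then have "N (s n) \<le> (\<Sum>m<M. N (s m))"
      using assms by (intro member_le_sum) (auto simp: N_nonneg)
    then show ?thesis unfolding B_def using N_nonneg[of "s M"] assms by simp
  next
    case False
    then have "N (s n) \<le> N (s M) + 1"
      using N_diff_abs[of "s n" "s M"] M[of n M] assms by simp
    moreover have "0 \<le> (\<Sum>m<M. N (s m))" using assms by (auto intro!: sum_nonneg N_nonneg)
    ultimately show ?thesis unfolding B_def by simp
  qed
  moreover have "B > 0"
    unfolding B_def using assms
    by (intro add_pos_nonneg sum_nonneg add_nonneg_pos N_nonneg) auto
  ultimately show ?thesis using that by blast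
qed

lemma C_add:
  assumes s: "s \<in> C" and t: "t \<in> C"
  shows "(\<lambda>n. s n \<oplus> t n) \<in> C"
proof (rule C_I)
  fix e :: real assume "0 < e"
  then obtain M1 M2 where "\<forall>m\<ge>M1. \<forall>n\<ge>M1. N (s m \<ominus> s n) < e / 2" "\<forall>m\<ge>M2. \<forall>n\<ge>M2. N (t m \<ominus> t n) < e / 2"
    using C_D[OF s, of "e / 2"] C_D[OF t, of "e / 2"] by auto
  then have "N ((s m \<oplus> t m) \<ominus> (s n \<oplus> t n)) < e" if "m \<ge> max M1 M2" "n \<ge> max M1 M2" for m n
    using N_add_diff[of "s m" "t m" "s n" "t n"] s t that by (smt (verit) C_closed field_sum_of_halves max.bounded_iff)
  then show "\<exists>M. \<forall>m\<ge>M. \<forall>n\<ge>M. N ((s m \<oplus> t m) \<ominus> (s n \<oplus> t n)) < e" by blast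
qed (use s t in auto)

lemma C_mult:
  assumes s: "s \<in> C" and t: "t \<in> C"
  shows "(\<lambda>n. s n \<otimes> t n) \<in> C"
proof (rule C_I)
  fix e :: real assume e: "0 < e"
  obtain B where B: "B > 0" "\<And>n. N (s n) \<le> B" using C_bounded[OF s] by blast
  obtain D where D: "D > 0" "\<And>n. N (t n) \<le> D" using C_bounded[OF t] by blast
  obtain M1 where M1: "\<forall>m\<ge>M1. \<forall>n\<ge>M1. N (s m \<ominus> s n) < e / (2 * D)"
    using C_D[OF s, of "e / (2 * D)"] e D by auto
  obtain M2 where M2: "\<forall>m\<ge>M2. \<forall>n\<ge>M2. N (t m \<ominus> t n) < e / (2 * B)"
    using C_D[OF t, of "e / (2 * B)"] e B by auto
  have "N ((s m \<otimes> t m) \<ominus> (s n \<otimes> t n)) < e" if "m \<ge> max M1 M2" "n \<ge> max M1 M2" for m n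
  proof -
    have "N ((s m \<otimes> t m) \<ominus> (s n \<otimes> t n)) \<le> N (s m \<ominus> s n) * N (t m) + N (s n) * N (t m \<ominus> t n)"
      using s t by (intro N_mult_diff) auto
    also have "\<dots> \<le> N (s m \<ominus> s n) * D + B * N (t m \<ominus> t n)"
      using s t by (intro add_mono mult_mono B D order_refl N_nonneg minus_closed C_closed) (use B D in auto)
    also have "\<dots> < e / (2 * D) * D + B * (e / (2 * B))"
      using that M1 M2 B D by (intro add_strict_mono mult_strict_right_mono mult_strict_left_mono) auto
    also have "\<dots> = e" using B D by simp
    finally show ?thesis .
  qed
  then show "\<exists>M. \<forall>m\<ge>M. \<forall>n\<ge>M. N ((s m \<otimes> t m) \<ominus> (s n \<otimes> t n)) < e" by blast
qed (use s t in auto)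

lemma C_adj: "s \<in> C \<Longrightarrow> (\<lambda>n. adj A (s n)) \<in> C"
  using C_D[of s] by (intro C_I) (auto simp: N_adj_diff)

lemma C_minus: "s \<in> C \<Longrightarrow> (\<lambda>n. \<ominus> s n) \<in> C"
proof (rule C_I)
  fix e :: real assume s: "s \<in> C" and "0 < e"
  have "N (\<ominus> s m \<ominus> \<ominus> s n) = N (s m \<ominus> s n)" for m n
    using N_uminus[of "s m \<ominus> s n"] s by (simp add: a_minus_def minus_add)
  then show "\<exists>M. \<forall>m\<ge>M. \<forall>n\<ge>M. N (\<ominus> s m \<ominus> \<ominus> s n) < e"
    using C_D[OF s \<open>0 < e\<close>] by simp
qed auto

lemma rel_iff: "(s, t) \<in> env_rel A \<longleftrightarrow> s \<in> C \<and> t \<in> C \<and> (\<lambda>n. N (s n \<ominus> t n)) \<longlonglongrightarrow> 0"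
  by (simp add: env_rel_def)

lemma null_bound:
  assumes "f \<longlonglongrightarrow> 0" "\<And>n. x n \<in> carrier A" "\<And>n. N (x n) \<le> f n"
  shows "(\<lambda>n. N (x n)) \<longlonglongrightarrow> 0"
  by (rule tendsto_sandwich[OF _ _ tendsto_const assms(1)]) (use assms N_nonneg in auto)

lemma equiv_rel: "equiv C (env_rel A)"
proof (rule equivI)
  show "env_rel A \<subseteq> C \<times> C" by (auto simp: rel_iff)
  show "refl_on C (env_rel A)"
    by (rule refl_onI) (auto simp: rel_iff a_minus_def r_neg N_zero)
  show "sym (env_rel A)"
    by (rule symI) (auto simp: rel_iff N_diff_commute)
  show "trans (env_rel A)"
  proof (rule transI)
    fix s t u assume "(s, t) \<in> env_rel A" "(t, u) \<in> env_rel A"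
    then have *: "s \<in> C" "t \<in> C" "u \<in> C" "(\<lambda>n. N (s n \<ominus> t n)) \<longlonglongrightarrow> 0" "(\<lambda>n. N (t n \<ominus> u n)) \<longlonglongrightarrow> 0"
      by (auto simp: rel_iff)
    have "(\<lambda>n. N (s n \<ominus> u n)) \<longlonglongrightarrow> 0"
      by (rule null_bound[OF tendsto_add_zero[OF *(4,5)]]) (simp_all add: N_diff_triangle *)
    then show "(s, u) \<in> env_rel A" using * by (simp add: rel_iff)
  qed
qed

lemma cls_eqI: "s \<in> C \<Longrightarrow> t \<in> C \<Longrightarrow> (\<lambda>n. N (s n \<ominus> t n)) \<longlonglongrightarrow> 0 \<Longrightarrow> cls s = cls t"
  unfolding cls_def by (rule equiv_class_eq[OF equiv_rel]) (simp add: rel_iff)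

lemma rel_add:
  assumes "(s, s') \<in> env_rel A" "(t, t') \<in> env_rel A"
  shows "((\<lambda>n. s n \<oplus> t n), (\<lambda>n. s' n \<oplus> t' n)) \<in> env_rel A"
proof -
  have *: "s \<in> C" "s' \<in> C" "t \<in> C" "t' \<in> C"
    "(\<lambda>n. N (s n \<ominus> s' n)) \<longlonglongrightarrow> 0" "(\<lambda>n. N (t n \<ominus> t' n)) \<longlonglongrightarrow> 0"
    using assms by (auto simp: rel_iff)
  have "(\<lambda>n. N ((s n \<oplus> t n) \<ominus> (s' n \<oplus> t' n))) \<longlonglongrightarrow> 0"
    by (rule null_bound[OF tendsto_add_zero[OF *(5,6)]]) (simp_all add: N_add_diff *)
  then show ?thesis using * by (simp add: rel_iff C_add)
qed

lemma rel_mult: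
  assumes "(s, s') \<in> env_rel A" "(t, t') \<in> env_rel A"
  shows "((\<lambda>n. s n \<otimes> t n), (\<lambda>n. s' n \<otimes> t' n)) \<in> env_rel A"
proof -
  have *: "s \<in> C" "s' \<in> C" "t \<in> C" "t' \<in> C"
    "(\<lambda>n. N (s n \<ominus> s' n)) \<longlonglongrightarrow> 0" "(\<lambda>n. N (t n \<ominus> t' n)) \<longlonglongrightarrow> 0"
    using assms by (auto simp: rel_iff)
  obtain B where B: "B > 0" "\<And>n. N (s' n) \<le> B" using C_bounded[OF *(2)] by blast
  obtain D where D: "D > 0" "\<And>n. N (t n) \<le> D" using C_bounded[OF *(3)] by blast
  have lim: "(\<lambda>n. N (s n \<ominus> s' n) * D + B * N (t n \<ominus> t' n)) \<longlonglongrightarrow> 0"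
    using *(5,6) by (intro tendsto_add_zero tendsto_mult_left_zero tendsto_mult_right_zero)
  have "(\<lambda>n. N ((s n \<otimes> t n) \<ominus> (s' n \<otimes> t' n))) \<longlonglongrightarrow> 0"
  proof (rule null_bound[OF lim])
    fix n
    have "N ((s n \<otimes> t n) \<ominus> (s' n \<otimes> t' n)) \<le> N (s n \<ominus> s' n) * N (t n) + N (s' n) * N (t n \<ominus> t' n)"
      using * by (intro N_mult_diff) auto
    also have "\<dots> \<le> N (s n \<ominus> s' n) * D + B * N (t n \<ominus> t' n)"
      using * by (intro add_mono mult_mono B D order_refl N_nonneg minus_closed C_closed) (use B D in auto)
    finally show "N ((s n \<otimes> t n) \<ominus> (s' n \<otimes> t' n)) \<le> N (s n \<ominus> s' n) * D + B * N (t n \<ominus> t' n)" .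
  qed (use * in auto)
  then show ?thesis using * by (simp add: rel_iff C_mult)
qed

lemma rel_adj:
  "(s, s') \<in> env_rel A \<Longrightarrow> ((\<lambda>n. adj A (s n)), (\<lambda>n. adj A (s' n))) \<in> env_rel A"
  by (auto simp: rel_iff C_adj N_adj_diff)

lemma cls_eq: "(s, t) \<in> env_rel A \<Longrightarrow> cls s = cls t"
  unfolding cls_def by (rule equiv_class_eq[OF equiv_rel])

text \<open>The union over representatives in \<open>enveloping\<close> collapses because the class
  of the termwise product depends only on the classes of the factors, by
  \<open>rel_mult\<close>.\<close>

lemma env_mult: "s \<in> C \<Longrightarrow> t \<in> C \<Longrightarrow> cls s \<otimes>\<^bsub>enveloping A\<^esub> cls t = cls (\<lambda>n. s n \<otimes> t n)"
proof -
  assume "s \<in> C" "t \<in> C"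
  moreover have "congruent2 (env_rel A) (env_rel A) (\<lambda>s t. cls (\<lambda>n. s n \<otimes> t n))"
    by (rule congruent2I'[OF cls_eq[OF rel_mult]])
  ultimately show ?thesis
    using UN_equiv_class2[OF equiv_rel equiv_rel, of "\<lambda>s t. cls (\<lambda>n. s n \<otimes> t n)" s t]
    by (simp add: enveloping_def cls_def[symmetric])
qed

lemma env_add: "s \<in> C \<Longrightarrow> t \<in> C \<Longrightarrow> cls s \<oplus>\<^bsub>enveloping A\<^esub> cls t = cls (\<lambda>n. s n \<oplus> t n)"
proof -
  assume "s \<in> C" "t \<in> C"
  moreover have "congruent2 (env_rel A) (env_rel A) (\<lambda>s t. cls (\<lambda>n. s n \<oplus> t n))"
    by (rule congruent2I'[OF cls_eq[OF rel_add]])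
  ultimately show ?thesis
    using UN_equiv_class2[OF equiv_rel equiv_rel, of "\<lambda>s t. cls (\<lambda>n. s n \<oplus> t n)" s t]
    by (simp add: enveloping_def cls_def[symmetric])
qed

lemma env_adj: "s \<in> C \<Longrightarrow> adj (enveloping A) (cls s) = cls (\<lambda>n. adj A (s n))"
proof -
  assume "s \<in> C"
  moreover have "congruent (env_rel A) (\<lambda>s. cls (\<lambda>n. adj A (s n)))"
    by (rule congruentI[OF cls_eq[OF rel_adj]])
  ultimately show ?thesis
    using UN_equiv_class[OF equiv_rel, of "\<lambda>s. cls (\<lambda>n. adj A (s n))" s]
    by (simp add: enveloping_def cls_def[symmetric])
qed

lemma env_zero: "\<zero>\<^bsub>enveloping A\<^esub> = cls (\<lambda>_. \<zero>)" and env_one: "\<one>\<^bsub>enveloping A\<^esub> = cls (\<lambda>_. \<one>)"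
  by (simp_all add: enveloping_def env_embed_def cls_def)

lemma env_carrier: "carrier (enveloping A) = cls ` C"
  by (auto simp: enveloping_def quotient_def cls_def)

lemma env_embed_eq: "env_embed A x = cls (\<lambda>_. x)"
  by (simp add: env_embed_def cls_def)

section \<open>Completions of sub-*-rings and norm closures\<close>

definition star_subring :: "'a set \<Rightarrow> bool" where
  "star_subring S \<longleftrightarrow> S \<subseteq> carrier A \<and> \<one> \<in> S \<and> \<zero> \<in> S \<and> (\<forall>x\<in>S. \<ominus> x \<in> S \<and> adj A x \<in> S) \<and>
     (\<forall>x\<in>S. \<forall>y\<in>S. x \<oplus> y \<in> S \<and> x \<otimes> y \<in> S)"

text \<open>Classes are still taken with respect to the norm of the whole algebra; only the carrier
  shrinks, to classes with a Cauchy representative in S. The enveloping algebra and the quantum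
  sphere are both instances, so one proof of the ring axioms serves both.\<close>

definition completion :: "'a set \<Rightarrow> (nat \<Rightarrow> 'a) set star_algebra" where
  "completion S = (enveloping A)\<lparr>carrier := cls ` (C \<inter> {s. range s \<subseteq> S})\<rparr>"

text \<open>Every axiom holds termwise on representatives, and closure of S under the operations
  keeps these representatives inside S.\<close>

lemma star_ring_completion:
  assumes S: "star_subring S"
  shows "star_ring (completion S)"
proof -
  let ?C = "C \<inter> {s. range s \<subseteq> S}"
  let ?B = "completion S"
  have carr: "carrier ?B = cls ` ?C" by (simp add: completion_def)
  have mult: "cls s \<otimes>\<^bsub>?B\<^esub> cls t = cls (\<lambda>n. s n \<otimes> t n)" if "s \<in> C" "t \<in> C" for s t
    using that env_mult by (simp add: completion_def)
  have add: "cls s \<oplus>\<^bsub>?B\<^esub> cls t = cls (\<lambda>n. s n \<oplus> t n)" if "s \<in> C" "t \<in> C" for s t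
    using that env_add by (simp add: completion_def)
  have adj: "adj ?B (cls s) = cls (\<lambda>n. adj A (s n))" if "s \<in> C" for s
    using that env_adj by (simp add: completion_def)
  have zero: "\<zero>\<^bsub>?B\<^esub> = cls (\<lambda>_. \<zero>)" and one: "\<one>\<^bsub>?B\<^esub> = cls (\<lambda>_. \<one>)"
    by (simp_all add: completion_def env_zero env_one)
  have memb: "(\<lambda>_. \<zero>) \<in> ?C" "(\<lambda>_. \<one>) \<in> ?C"
    "\<And>s t. s \<in> ?C \<Longrightarrow> t \<in> ?C \<Longrightarrow> (\<lambda>n. s n \<oplus> t n) \<in> ?C"
    "\<And>s t. s \<in> ?C \<Longrightarrow> t \<in> ?C \<Longrightarrow> (\<lambda>n. s n \<otimes> t n) \<in> ?C"
    "\<And>s. s \<in> ?C \<Longrightarrow> (\<lambda>n. adj A (s n)) \<in> ?C" "\<And>s. s \<in> ?C \<Longrightarrow> (\<lambda>n. \<ominus> s n) \<in> ?C"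
    using S by (auto simp: C_add C_mult C_adj C_minus star_subring_def image_subset_iff)
  have "ring ?B"
  proof (rule ringI)
    show "abelian_group ?B"
    proof (rule abelian_groupI)
      fix X assume "X \<in> carrier ?B"
      then obtain s where s: "s \<in> ?C" "X = cls s" unfolding carr by blast
      have "cls (\<lambda>n. \<ominus> s n) \<oplus>\<^bsub>?B\<^esub> X = \<zero>\<^bsub>?B\<^esub>"
        using s by (simp add: add zero C_minus l_neg)
      then show "\<exists>Y\<in>carrier ?B. Y \<oplus>\<^bsub>?B\<^esub> X = \<zero>\<^bsub>?B\<^esub>"
        unfolding carr using memb(6)[OF s(1)] by blast
    qed (use memb in \<open>auto simp: carr add zero a_ac C_add intro!: imageI\<close>)
    show "Group.monoid ?B"
      by (rule monoidI) (use memb in \<open>auto simp: carr mult one m_assoc C_mult intro!: imageI\<close>)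
  qed (auto simp: carr mult add C_add C_mult l_distr r_distr)
  then show ?thesis
    by (rule star_ring.intro, intro star_ring_axioms.intro)
       (use memb in \<open>auto simp: carr mult add adj C_adj C_add C_mult adj_add adj_mult intro!: imageI\<close>)
qed

lemma star_subring_carrier: "star_subring (carrier A)"
  by (auto simp: star_subring_def)

lemma enveloping_eq_completion: "enveloping A = completion (carrier A)"
proof -
  have "C \<inter> {s. range s \<subseteq> carrier A} = C" by auto
  then show ?thesis by (simp add: completion_def env_carrier[symmetric])
qed

text \<open>Negation in \<open>enveloping A\<close> is the abstract inverse of its additive group;
  uniqueness of inverses identifies it with termwise negation.\<close>

lemma env_diff:
  assumes "s \<in> C" "t \<in> C"
  shows "cls s \<ominus>\<^bsub>enveloping A\<^esub> cls t = cls (\<lambda>n. s n \<ominus> t n)"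
proof -
  interpret E: star_ring "enveloping A"
    unfolding enveloping_eq_completion by (rule star_ring_completion[OF star_subring_carrier])
  have "\<ominus>\<^bsub>enveloping A\<^esub> cls t = cls (\<lambda>n. \<ominus> t n)"
    using assms by (intro E.minus_equality) (auto simp: env_add env_zero env_carrier C_minus l_neg)
  then show ?thesis
    using assms by (simp add: a_minus_def env_add C_minus)
qed

text \<open>\<open>completion_norm\<close> follows a representative picked by \<open>SOME\<close>.
  Equivalent sequences have norms differing by a null sequence, so any representative yields the
  same limit.\<close>

lemma completion_norm_tendsto:
  assumes "s \<in> C"
  shows "(\<lambda>n. N (s n)) \<longlonglongrightarrow> completion_norm A (cls s)"
proof -
  define t where "t = (SOME t. t \<in> cls s)"
  have "s \<in> cls s" unfolding cls_def by (rule equiv_class_self[OF equiv_rel assms])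
  then have "t \<in> cls s" unfolding t_def by (rule someI[where P = "\<lambda>t. t \<in> cls s"])
  then have t: "t \<in> C" "(\<lambda>n. N (s n \<ominus> t n)) \<longlonglongrightarrow> 0"
    by (auto simp: cls_def rel_iff)
  \<comment> \<open>\<open>lim\<close> denotes an actual limit only for convergent sequences, hence
    convergence along the chosen representative comes first.\<close>
  have "Cauchy (\<lambda>n. N (t n))"
  proof (rule CauchyI)
    fix e :: real assume "0 < e"
    then obtain M where M: "\<forall>m\<ge>M. \<forall>n\<ge>M. N (t m \<ominus> t n) < e" using C_D[OF t(1)] by blast
    have "norm (N (t m) - N (t n)) < e" if "m \<ge> M" "n \<ge> M" for m n
      using M that N_diff_abs[of "t m" "t n"] t(1) by (auto intro: le_less_trans)
    then show "\<exists>M. \<forall>m\<ge>M. \<forall>n\<ge>M. norm (N (t m) - N (t n)) < e" by blast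
  qed
  then have 1: "(\<lambda>n. N (t n)) \<longlonglongrightarrow> completion_norm A (cls s)"
    unfolding completion_norm_def t_def[symmetric]
    by (simp add: Cauchy_convergent_iff convergent_LIMSEQ_iff)
  have "(\<lambda>n. N (s n) - N (t n)) \<longlonglongrightarrow> 0"
    by (rule Lim_null_comparison[OF _ t(2)]) (use N_diff_abs assms t in auto)
  from tendsto_add[OF this 1] show ?thesis by simp
qed

text \<open>An element of the closure is approximated to within 1/(k+1) by some \<open>b k\<close>
  in S, and these approximants form a Cauchy sequence equivalent to the original representative.
  Norm closure thus becomes a statement about sequences in S.\<close>

lemma env_closure_eq:
  assumes S: "S \<subseteq> carrier A"
  shows "env_closure A S = cls ` (C \<inter> {s. range s \<subseteq> S})"
proof (intro equalityI subsetI)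
  fix X assume "X \<in> env_closure A S"
  then obtain s where s: "s \<in> C" "X = cls s"
    and close: "\<And>e. e > 0 \<Longrightarrow> \<exists>b\<in>S. completion_norm A (X \<ominus>\<^bsub>enveloping A\<^esub> env_embed A b) < e"
    unfolding env_closure_def env_carrier by auto
  have "\<exists>b\<in>S. \<exists>M. \<forall>n\<ge>M. N (s n \<ominus> b) < 1 / real (Suc k)" for k
  proof -
    obtain b where b: "b \<in> S" "completion_norm A (X \<ominus>\<^bsub>enveloping A\<^esub> env_embed A b) < 1 / real (Suc k)"
      using close[of "1 / real (Suc k)"] by auto
    then have "b \<in> carrier A" using S by auto
    then have C: "(\<lambda>n. s n \<ominus> b) \<in> C"
      using C_add[OF s(1) C_const[of "\<ominus> b"]] by (simp add: a_minus_def)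
    have "completion_norm A (cls (\<lambda>n. s n \<ominus> b)) < 1 / real (Suc k)"
      using b \<open>b \<in> carrier A\<close> s by (simp add: env_embed_eq env_diff)
    from order_tendstoD(2)[OF completion_norm_tendsto[OF C] this] b show ?thesis
      by (auto simp: eventually_sequentially)
  qed
  then obtain b M where b: "\<And>k. b k \<in> S" and M: "\<And>k n. n \<ge> M k \<Longrightarrow> N (s n \<ominus> b k) < 1 / real (Suc k)"
    by metis
  have bc: "b k \<in> carrier A" for k using b S by auto
  have bb: "N (b k \<ominus> b l) \<le> 1 / real (Suc k) + 1 / real (Suc l)" for k l
  proof -
    \<comment> \<open>\<open>b k\<close> and \<open>b l\<close> are compared through one term of s
      beyond both thresholds.\<close>
    define n where "n = max (M k) (M l)"
    have "N (b k \<ominus> b l) \<le> N (b k \<ominus> s n) + N (s n \<ominus> b l)"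
      using bc s by (intro N_diff_triangle) auto
    then show ?thesis
      using M[of k n] M[of l n] N_diff_commute[of "b k" "s n"] bc s by (simp add: n_def)
  qed
  have small: "\<exists>K. \<forall>k\<ge>K. 1 / real (Suc k) < e" if e: "e > 0" for e :: real
  proof -
    obtain K where K: "1 / real (Suc K) < e" using nat_approx_posE[OF e] by auto
    have "1 / real (Suc k) < e" if "k \<ge> K" for k
      using that by (intro le_less_trans[OF _ K]) (simp add: frac_le)
    then show ?thesis by blast
  qed
  have bC: "b \<in> C"
  proof (rule C_I)
    fix e :: real assume "e > 0"
    then obtain K where "\<forall>k\<ge>K. 1 / real (Suc k) < e / 2" using small[of "e / 2"] by auto
    then have "N (b k \<ominus> b l) < e" if "k \<ge> K" "l \<ge> K" for k l
      using bb[of k l] that by (smt (verit) field_sum_of_halves)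
    then show "\<exists>K. \<forall>k\<ge>K. \<forall>l\<ge>K. N (b k \<ominus> b l) < e" by blast
  qed (rule bc)
  have "(\<lambda>n. N (s n \<ominus> b n)) \<longlonglongrightarrow> 0"
  proof (rule LIMSEQ_I)
    fix e :: real assume "e > 0"
    then obtain K where K: "\<forall>k\<ge>K. 1 / real (Suc k) < e / 2" using small[of "e / 2"] by auto
    obtain L where L: "\<forall>m\<ge>L. \<forall>n\<ge>L. N (s m \<ominus> s n) < e / 2" using C_D[OF s(1), of "e / 2"] \<open>e > 0\<close> by auto
    have "norm (N (s n \<ominus> b n) - 0) < e" if n: "n \<ge> max K L" for n
    proof -
      \<comment> \<open>The auxiliary index must be late enough for \<open>b n\<close> to be close
        to \<open>s m\<close>, and late enough for the Cauchy estimate between \<open>s n\<close>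
        and \<open>s m\<close>.\<close>
      define m where "m = max (M n) L"
      have "N (s n \<ominus> b n) \<le> N (s n \<ominus> s m) + N (s m \<ominus> b n)"
        using bc s by (intro N_diff_triangle) auto
      also have "\<dots> < e / 2 + e / 2"
      proof (rule add_strict_mono)
        show "N (s n \<ominus> s m) < e / 2" using L n by (simp add: m_def)
        show "N (s m \<ominus> b n) < e / 2" using M[of n m] K n by (force simp: m_def)
      qed
      finally show ?thesis using N_nonneg[of "s n \<ominus> b n"] bc s by simp
    qed
    then show "\<exists>K. \<forall>n\<ge>K. norm (N (s n \<ominus> b n) - 0) < e" by blast
  qed
  then have "X = cls b" using s bC by (simp add: cls_eqI)
  then show "X \<in> cls ` (C \<inter> {s. range s \<subseteq> S})" using b bC by blast
next
  fix X assume "X \<in> cls ` (C \<inter> {s. range s \<subseteq> S})"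
  then obtain s where s: "s \<in> C" "\<And>n. s n \<in> S" "X = cls s" by auto
  have "\<exists>b\<in>S. completion_norm A (X \<ominus>\<^bsub>enveloping A\<^esub> env_embed A b) < e" if e: "e > 0" for e
  proof -
    obtain M where M: "\<forall>m\<ge>M. \<forall>n\<ge>M. N (s m \<ominus> s n) < e / 2" using C_D[OF s(1), of "e / 2"] e by auto
    have C: "(\<lambda>n. s n \<ominus> s M) \<in> C"
      using C_add[OF s(1) C_const[of "\<ominus> s M"]] s by (simp add: a_minus_def)
    \<comment> \<open>Only a weak inequality survives the limit; starting from e / 2 keeps the final
      bound strict.\<close>
    have "completion_norm A (cls (\<lambda>n. s n \<ominus> s M)) \<le> e / 2"
      by (rule LIMSEQ_le_const2[OF completion_norm_tendsto[OF C]]) (use M in force)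
    then have "completion_norm A (X \<ominus>\<^bsub>enveloping A\<^esub> env_embed A (s M)) < e"
      using s that by (simp add: env_embed_eq env_diff)
    then show ?thesis using s by blast
  qed
  then show "X \<in> env_closure A S" unfolding env_closure_def env_carrier using s by blast
qed

lemma closure_eq_completion:
  assumes "star_subring S"
  shows "(enveloping A)\<lparr>carrier := env_closure A S\<rparr> = completion S"
  using assms by (simp add: completion_def env_closure_eq star_subring_def)

end

section \<open>The crossed product\<close>

lemma crossed_simps:
  "carrier (crossed q) = {a. finite {k. a k \<noteq> (\<lambda>_. 0)} \<and> (\<forall>k. continuous_on UNIV (a k))}"
  "mult (crossed q) a b = (\<lambda>m x. \<Sum>k | a k \<noteq> (\<lambda>_. 0). a k x * alpha q k (b (m - k)) x)"
  "one (crossed q) = (\<lambda>k _. if k = 0 then 1 else 0)"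
  "zero (crossed q) = (\<lambda>_ _. 0)"
  "add (crossed q) a b = (\<lambda>k x. a k x + b k x)"
  "smult (crossed q) c a = (\<lambda>k x. c * a k x)"
  "adj (crossed q) a = (\<lambda>k. alpha q k (\<lambda>x. cnj (a (- k) x)))"
  by (simp_all add: crossed_def)

locale crossed_product =
  fixes q :: real
  assumes q_pos: "0 < q"
begin

abbreviation (input) "R \<equiv> crossed q"

lemma alpha_zero [simp]: "alpha q 0 f = f"
  by (simp add: alpha_def)

lemma alpha_alpha [simp]: "alpha q k (alpha q l f) = alpha q (k + l) f"
proof -
  have "ennreal (q powi (k + l)) = ennreal (q powi l) * ennreal (q powi k)"
    using q_pos by (subst ennreal_mult[symmetric]) (auto simp: power_int_add)
  then show ?thesis by (simp add: alpha_def mult.assoc)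
qed

lemma alpha_apply: "alpha q k (\<lambda>x. F (f x)) = (\<lambda>x. F (alpha q k f x))"
  by (simp add: alpha_def)

lemma alpha_const [simp]: "alpha q k (\<lambda>_. c) = (\<lambda>_. c)"
  by (simp add: alpha_def)

lemma alpha_at_0 [simp]: "alpha q k f 0 = f 0"
  by (simp add: alpha_def)

lemma alpha_at_top [simp]: "alpha q k f top_class.top = f top_class.top"
  using q_pos by (simp add: alpha_def ennreal_mult_top)

lemma continuous_alpha:
  assumes "continuous_on UNIV f" shows "continuous_on UNIV (alpha q k f)"
proof -
  have "continuous_on UNIV (\<lambda>x. ennreal (q powi k) * x)"
    by (intro ennreal_continuous_on_cmult continuous_on_id) simp
  then show ?thesis
    unfolding alpha_def by (rule continuous_on_compose2[OF assms]) simp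
qed

text \<open>The product sums over the exact support of its left factor. Allowing any finite superset
  makes sums over different supports comparable.\<close>

lemma mult_eq_sum:
  assumes "finite K" "\<And>k. k \<notin> K \<Longrightarrow> a k = (\<lambda>_. 0)"
  shows "(a \<otimes>\<^bsub>R\<^esub> b) m x = (\<Sum>k\<in>K. a k x * alpha q k (b (m - k)) x)"
  unfolding crossed_simps by (rule sum.mono_neutral_left) (use assms in auto)

definition support :: "fin_sum \<Rightarrow> int set" where "support a = {k. a k \<noteq> (\<lambda>_. 0)}"

lemma not_support: "k \<notin> support a \<Longrightarrow> a k = (\<lambda>_. 0)"
  by (simp add: support_def)

lemma carrier_iff: "a \<in> carrier R \<longleftrightarrow> finite (support a) \<and> (\<forall>k. continuous_on UNIV (a k))"
  by (simp add: crossed_simps support_def)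

lemma mult_support: "(a \<otimes>\<^bsub>R\<^esub> b) m x = (\<Sum>k\<in>support a. a k x * alpha q k (b (m - k)) x)"
  by (simp add: crossed_simps support_def)

lemma support_mult: "support (a \<otimes>\<^bsub>R\<^esub> b) \<subseteq> (\<lambda>(k, l). k + l) ` (support a \<times> support b)"
proof
  fix m assume "m \<in> support (a \<otimes>\<^bsub>R\<^esub> b)"
  then obtain x where "(a \<otimes>\<^bsub>R\<^esub> b) m x \<noteq> 0" by (auto simp: support_def)
  then obtain k where "k \<in> support a" "a k x * alpha q k (b (m - k)) x \<noteq> 0"
    unfolding mult_support by (meson sum.neutral)
  then have "k \<in> support a" "m - k \<in> support b" by (auto simp: support_def alpha_def)
  then show "m \<in> (\<lambda>(k, l). k + l) ` (support a \<times> support b)"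
    by (intro image_eqI[of _ _ "(k, m - k)"]) auto
qed

lemma crossed_mult_closed: "a \<in> carrier R \<Longrightarrow> b \<in> carrier R \<Longrightarrow> a \<otimes>\<^bsub>R\<^esub> b \<in> carrier R"
  using finite_subset[OF support_mult[of a b]]
  by (auto simp: carrier_iff mult_support[abs_def] intro!: continuous_on_sum continuous_on_mult continuous_alpha)

lemma crossed_mult_assoc:
  assumes "a \<in> carrier R" "b \<in> carrier R"
  shows "(a \<otimes>\<^bsub>R\<^esub> b) \<otimes>\<^bsub>R\<^esub> c = a \<otimes>\<^bsub>R\<^esub> (b \<otimes>\<^bsub>R\<^esub> c)"
proof (intro ext)
  fix m x
  define K where "K = support a" define L where "L = support b"
  \<comment> \<open>A finite set of degrees containing the support of the product a b. After the
    sums are exchanged, only j = k + l with l in the support of b contributes, which gives the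
    reindexing.\<close>
  define J where "J = (\<lambda>(k, l). k + l) ` (K \<times> L)"
  have fin: "finite K" "finite L" "finite J"
    using assms by (auto simp: carrier_iff K_def L_def J_def)
  have "((a \<otimes>\<^bsub>R\<^esub> b) \<otimes>\<^bsub>R\<^esub> c) m x = (\<Sum>j\<in>J. (a \<otimes>\<^bsub>R\<^esub> b) j x * alpha q j (c (m - j)) x)"
    using support_mult[of a b] by (intro mult_eq_sum fin) (auto simp: J_def K_def L_def intro: not_support)
  also have "\<dots> = (\<Sum>j\<in>J. \<Sum>k\<in>K. a k x * alpha q k (b (j - k)) x * alpha q j (c (m - j)) x)"
    by (simp add: mult_support K_def sum_distrib_right)
  also have "\<dots> = (\<Sum>k\<in>K. \<Sum>j\<in>J. a k x * alpha q k (b (j - k)) x * alpha q j (c (m - j)) x)"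
    by (rule sum.swap)
  also have "\<dots> = (\<Sum>k\<in>K. a k x * alpha q k ((b \<otimes>\<^bsub>R\<^esub> c) (m - k)) x)"
  proof (rule sum.cong[OF refl])
    fix k assume k: "k \<in> K"
    have "(\<Sum>j\<in>J. a k x * alpha q k (b (j - k)) x * alpha q j (c (m - j)) x) =
        (\<Sum>j\<in>(+) k ` L. a k x * alpha q k (b (j - k)) x * alpha q j (c (m - j)) x)"
    proof (rule sum.mono_neutral_right)
      show "\<forall>j\<in>J - (+) k ` L. a k x * alpha q k (b (j - k)) x * alpha q j (c (m - j)) x = 0"
      proof
        fix j assume "j \<in> J - (+) k ` L"
        then have "j - k \<notin> support b" unfolding L_def by (metis DiffD2 add_diff_cancel_left' diff_add_cancel add.commute imageI)
        then show "a k x * alpha q k (b (j - k)) x * alpha q j (c (m - j)) x = 0"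
          by (simp add: not_support)
      qed
    qed (use k fin in \<open>auto simp: J_def\<close>)
    also have "\<dots> = (\<Sum>l\<in>L. a k x * alpha q k (b l) x * alpha q (k + l) (c (m - (k + l))) x)"
      by (simp add: sum.reindex)
    also have "\<dots> = (\<Sum>l\<in>L. a k x * (alpha q k (b l) x * alpha q k (alpha q l (c (m - k - l))) x))"
      by (simp add: mult.assoc diff_diff_eq)
    also have "\<dots> = a k x * alpha q k ((b \<otimes>\<^bsub>R\<^esub> c) (m - k)) x"
      unfolding mult_support[abs_def] L_def[symmetric] sum_distrib_left[symmetric]
      by (simp add: alpha_def)
    finally show "(\<Sum>j\<in>J. a k x * alpha q k (b (j - k)) x * alpha q j (c (m - j)) x) =
        a k x * alpha q k ((b \<otimes>\<^bsub>R\<^esub> c) (m - k)) x" .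
  qed
  also have "\<dots> = (a \<otimes>\<^bsub>R\<^esub> (b \<otimes>\<^bsub>R\<^esub> c)) m x"
    by (simp add: mult_support[of a] K_def)
  finally show "((a \<otimes>\<^bsub>R\<^esub> b) \<otimes>\<^bsub>R\<^esub> c) m x = (a \<otimes>\<^bsub>R\<^esub> (b \<otimes>\<^bsub>R\<^esub> c)) m x" .
qed

lemma crossed_add_closed:
  assumes "a \<in> carrier R" "b \<in> carrier R"
  shows "a \<oplus>\<^bsub>R\<^esub> b \<in> carrier R"
proof -
  have "support (a \<oplus>\<^bsub>R\<^esub> b) \<subseteq> support a \<union> support b"
    by (auto simp: support_def crossed_simps)
  then have "finite (support (a \<oplus>\<^bsub>R\<^esub> b))"
    using assms by (auto simp: carrier_iff intro: finite_subset)
  then show ?thesis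
    using assms by (auto simp: carrier_iff crossed_simps(5) intro!: continuous_on_add)
qed

lemma crossed_smult_closed:
  assumes "a \<in> carrier R"
  shows "c \<odot>\<^bsub>R\<^esub> a \<in> carrier R"
proof -
  have "support (c \<odot>\<^bsub>R\<^esub> a) \<subseteq> support a"
    by (auto simp: support_def crossed_simps)
  then have "finite (support (c \<odot>\<^bsub>R\<^esub> a))"
    using assms by (auto simp: carrier_iff intro: finite_subset)
  then show ?thesis
    using assms by (auto simp: carrier_iff crossed_simps(6) intro!: continuous_on_mult)
qed

lemma crossed_adj_closed:
  assumes "a \<in> carrier R"
  shows "adj R a \<in> carrier R"
proof -
  have "support (adj R a) \<subseteq> uminus ` support a"
  proof
    fix k assume "k \<in> support (adj R a)"
    then have "- k \<in> support a" by (auto simp: support_def crossed_simps alpha_def)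
    then show "k \<in> uminus ` support a" by (metis imageI minus_minus)
  qed
  then have "finite (support (adj R a))"
    using assms by (auto simp: carrier_iff intro: finite_subset)
  then show ?thesis
    using assms by (auto simp: carrier_iff crossed_simps(7) intro!: continuous_alpha continuous_on_cnj)
qed

lemma crossed_one_zero_closed: "\<one>\<^bsub>R\<^esub> \<in> carrier R" "\<zero>\<^bsub>R\<^esub> \<in> carrier R"
  by (auto simp: crossed_simps intro: finite_subset[of _ "{0}"])

lemma crossed_adj_mult:
  assumes "a \<in> carrier R" "b \<in> carrier R"
  shows "adj R (a \<otimes>\<^bsub>R\<^esub> b) = adj R b \<otimes>\<^bsub>R\<^esub> adj R a"
proof (intro ext)
  fix m x
  define K where "K = support a"
  \<comment> \<open>Contains the support of adj b, over which the product adj b adj a is summed, and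
    the shift by m of the support of a. Terms outside that shift vanish, and j = m + k reindexes the
    rest.\<close>
  define J where "J = support (adj R b) \<union> (+) m ` K"
  have fin: "finite K" "finite J"
    using assms crossed_adj_closed[OF assms(2)] by (auto simp: carrier_iff K_def J_def)
  have coeff: "adj R b j x * alpha q j (adj R a (m - j)) x =
      cnj (alpha q m (a (j - m)) x * alpha q j (b (- j)) x)" for j
    by (simp add: crossed_simps alpha_apply[of _ cnj] mult.commute)
  have "(adj R b \<otimes>\<^bsub>R\<^esub> adj R a) m x = (\<Sum>j\<in>J. cnj (alpha q m (a (j - m)) x * alpha q j (b (- j)) x))"
    unfolding coeff[symmetric] by (intro mult_eq_sum fin) (auto simp: J_def intro: not_support)
  also have "\<dots> = (\<Sum>j\<in>(+) m ` K. cnj (alpha q m (a (j - m)) x * alpha q j (b (- j)) x))"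
  proof (rule sum.mono_neutral_right)
    show "\<forall>j\<in>J - (+) m ` K. cnj (alpha q m (a (j - m)) x * alpha q j (b (- j)) x) = 0"
    proof
      fix j assume "j \<in> J - (+) m ` K"
      then have "j - m \<notin> support a" unfolding K_def by (metis DiffD2 diff_add_cancel add.commute imageI)
      then show "cnj (alpha q m (a (j - m)) x * alpha q j (b (- j)) x) = 0"
        by (simp add: not_support)
    qed
  qed (use fin in \<open>auto simp: J_def\<close>)
  also have "\<dots> = (\<Sum>k\<in>K. cnj (alpha q m (a k) x * alpha q (m + k) (b (- m - k)) x))"
    by (simp add: sum.reindex)
  also have "\<dots> = cnj (\<Sum>k\<in>K. alpha q m (\<lambda>x. a k x * alpha q k (b (- m - k)) x) x)"
    by (simp add: alpha_def[of q m] alpha_alpha[symmetric] del: alpha_alpha)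
  also have "\<dots> = adj R (a \<otimes>\<^bsub>R\<^esub> b) m x"
    by (simp add: crossed_simps(7) mult_support K_def alpha_def[of q m])
  finally show "adj R (a \<otimes>\<^bsub>R\<^esub> b) m x = (adj R b \<otimes>\<^bsub>R\<^esub> adj R a) m x" by simp
qed

lemma crossed_l_distr:
  assumes "a \<in> carrier R" "b \<in> carrier R"
  shows "(a \<oplus>\<^bsub>R\<^esub> b) \<otimes>\<^bsub>R\<^esub> c = a \<otimes>\<^bsub>R\<^esub> c \<oplus>\<^bsub>R\<^esub> b \<otimes>\<^bsub>R\<^esub> c"
proof (intro ext)
  fix m x
  have fin: "finite (support a \<union> support b)" using assms by (auto simp: carrier_iff)
  have "(d \<otimes>\<^bsub>R\<^esub> c) m x = (\<Sum>k\<in>support a \<union> support b. d k x * alpha q k (c (m - k)) x)"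
    if "d = a \<or> d = b \<or> d = a \<oplus>\<^bsub>R\<^esub> b" for d
    by (rule mult_eq_sum[OF fin]) (use that in \<open>auto simp: support_def crossed_simps(5)\<close>)
  then show "((a \<oplus>\<^bsub>R\<^esub> b) \<otimes>\<^bsub>R\<^esub> c) m x = (a \<otimes>\<^bsub>R\<^esub> c \<oplus>\<^bsub>R\<^esub> b \<otimes>\<^bsub>R\<^esub> c) m x"
    by (simp add: crossed_simps(5) distrib_right sum.distrib)
qed

lemma crossed_r_distr:
  "c \<otimes>\<^bsub>R\<^esub> (a \<oplus>\<^bsub>R\<^esub> b) = c \<otimes>\<^bsub>R\<^esub> a \<oplus>\<^bsub>R\<^esub> c \<otimes>\<^bsub>R\<^esub> b"
  by (simp add: crossed_simps alpha_def distrib_left sum.distrib)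

lemma star_ring_crossed: "star_ring R"
proof -
  have neg: "(- 1) \<odot>\<^bsub>R\<^esub> a \<oplus>\<^bsub>R\<^esub> a = \<zero>\<^bsub>R\<^esub>" for a
    by (simp add: crossed_simps)
  have "ring R"
  proof (rule ringI)
    show "abelian_group R"
    proof (rule abelian_groupI)
      fix a assume "a \<in> carrier R"
      then show "\<exists>b\<in>carrier R. b \<oplus>\<^bsub>R\<^esub> a = \<zero>\<^bsub>R\<^esub>"
        using neg crossed_smult_closed by blast
    qed (auto simp: crossed_add_closed crossed_one_zero_closed, auto simp: crossed_simps ac_simps)
    show "Group.monoid R"
    proof (rule monoidI)
      fix a assume a: "a \<in> carrier R"
      show "\<one>\<^bsub>R\<^esub> \<otimes>\<^bsub>R\<^esub> a = a"
        by (intro ext, subst mult_eq_sum[of "{0}"]) (auto simp: crossed_simps)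
      show "a \<otimes>\<^bsub>R\<^esub> \<one>\<^bsub>R\<^esub> = a"
      proof (intro ext)
        fix m x
        have "(a \<otimes>\<^bsub>R\<^esub> \<one>\<^bsub>R\<^esub>) m x = (\<Sum>k\<in>support a. if k = m then a k x else 0)"
          unfolding mult_support by (rule sum.cong) (auto simp: crossed_simps alpha_def)
        also have "\<dots> = a m x"
          using a by (simp add: carrier_iff not_support)
        finally show "(a \<otimes>\<^bsub>R\<^esub> \<one>\<^bsub>R\<^esub>) m x = a m x" .
      qed
    qed (auto simp: crossed_mult_closed crossed_one_zero_closed crossed_mult_assoc)
  qed (auto simp: crossed_l_distr crossed_r_distr)
  then show ?thesis
  proof (rule star_ring.intro, intro star_ring_axioms.intro)
    fix a b
    show "adj R (a \<oplus>\<^bsub>R\<^esub> b) = adj R a \<oplus>\<^bsub>R\<^esub> adj R b"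
      by (simp add: crossed_simps alpha_def)
    show "adj R (adj R a) = a"
      by (simp add: crossed_simps alpha_apply[of _ cnj])
  qed (simp_all add: crossed_adj_closed crossed_adj_mult)
qed

end

sublocale crossed_product \<subseteq> star_ring "crossed q"
  by (rule star_ring_crossed)

section \<open>Monomials and the bound on C*-seminorms\<close>

context crossed_product
begin

text \<open>The element f U^k; all explicit elements below are sums of such terms.\<close>

definition monomial :: "(ennreal \<Rightarrow> complex) \<Rightarrow> int \<Rightarrow> fin_sum" where
  "monomial f k = (\<lambda>j. if j = k then f else (\<lambda>_. 0))"

lemma monomial_closed [simp]: "continuous_on UNIV f \<Longrightarrow> monomial f k \<in> carrier R"
  by (auto simp: crossed_simps monomial_def intro: finite_subset[of _ "{k}"])

lemma monomial_mult: "monomial f k \<otimes>\<^bsub>R\<^esub> monomial g l = monomial (\<lambda>x. f x * alpha q k g x) (k + l)"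
proof (intro ext)
  fix m x
  have "(monomial f k \<otimes>\<^bsub>R\<^esub> monomial g l) m x = (\<Sum>j\<in>{k}. monomial f k j x * alpha q j (monomial g l (m - j)) x)"
    by (rule mult_eq_sum) (auto simp: monomial_def)
  then show "(monomial f k \<otimes>\<^bsub>R\<^esub> monomial g l) m x = monomial (\<lambda>x. f x * alpha q k g x) (k + l) m x"
    by (auto simp: monomial_def)
qed

lemma monomial_add: "monomial f k \<oplus>\<^bsub>R\<^esub> monomial g k = monomial (\<lambda>x. f x + g x) k"
  by (auto simp: crossed_simps monomial_def)

lemma monomial_adj: "adj R (monomial f k) = monomial (alpha q (- k) (\<lambda>x. cnj (f x))) (- k)"
  by (auto simp: crossed_simps monomial_def fun_eq_iff alpha_def)

lemma monomial_smult: "c \<odot>\<^bsub>R\<^esub> monomial f k = monomial (\<lambda>x. c * f x) k"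
  by (auto simp: crossed_simps monomial_def fun_eq_iff)

lemma one_eq_monomial: "\<one>\<^bsub>R\<^esub> = monomial (\<lambda>_. 1) 0" and U_eq_monomial: "U = monomial (\<lambda>_. 1) 1"
  by (auto simp: crossed_simps monomial_def U_def fun_eq_iff)

lemma monomial_pow: "monomial (\<lambda>_. 1) k [^]\<^bsub>R\<^esub> n = monomial (\<lambda>_. 1) (k * int n)"
  by (induction n) (simp_all add: one_eq_monomial monomial_mult algebra_simps)

lemma minus_eq_smult: "a \<in> carrier R \<Longrightarrow> \<ominus>\<^bsub>R\<^esub> a = (- 1) \<odot>\<^bsub>R\<^esub> a"
  by (rule minus_equality) (simp_all add: crossed_smult_closed, simp add: crossed_simps)

context
  fixes p
  assumes p: "cstar_seminorm R p"
begin

lemma p_nonneg: "a \<in> carrier R \<Longrightarrow> 0 \<le> p a"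
  and p_add: "a \<in> carrier R \<Longrightarrow> b \<in> carrier R \<Longrightarrow> p (a \<oplus>\<^bsub>R\<^esub> b) \<le> p a + p b"
  and p_mult: "a \<in> carrier R \<Longrightarrow> b \<in> carrier R \<Longrightarrow> p (a \<otimes>\<^bsub>R\<^esub> b) \<le> p a * p b"
  and p_smult: "a \<in> carrier R \<Longrightarrow> p (c \<odot>\<^bsub>R\<^esub> a) = cmod c * p a"
  and p_adj_mult: "a \<in> carrier R \<Longrightarrow> p (adj R a \<otimes>\<^bsub>R\<^esub> a) = (p a)\<^sup>2"
  using p by (auto simp: cstar_seminorm_def)

text \<open>The C*-identity at the unit makes p 1 equal to its own square, hence 0 or 1; at a it
  makes the square of p a equal to p 1.\<close>

lemma p_isometry_le_1:
  assumes "a \<in> carrier R" "adj R a \<otimes>\<^bsub>R\<^esub> a = \<one>\<^bsub>R\<^esub>"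
  shows "p a \<le> 1"
proof -
  have "p \<one>\<^bsub>R\<^esub> = (p \<one>\<^bsub>R\<^esub>)\<^sup>2" using p_adj_mult[of "\<one>\<^bsub>R\<^esub>"] by simp
  then have "p \<one>\<^bsub>R\<^esub> \<le> 1" by (auto simp: power2_eq_square)
  then have "(p a)\<^sup>2 \<le> 1\<^sup>2" using p_adj_mult[OF assms(1)] assms(2) by simp
  then show ?thesis by (rule power2_le_imp_le) simp
qed

text \<open>A real function with values in \<open>[0, 1]\<close> is the mean of a unitary and its adjoint.\<close>

lemma p_real_le_1:
  assumes g: "continuous_on UNIV g" and "\<And>x. 0 \<le> g x" "\<And>x. g x \<le> 1"
  shows "p (monomial (\<lambda>x. complex_of_real (g x)) 0) \<le> 1"
proof -
  define w where "w x = Complex (g x) (sqrt (1 - (g x)\<^sup>2))" for x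
  have sq: "(g x)\<^sup>2 \<le> 1" for x using assms by (simp add: power_le_one)
  have w_eq: "w = (\<lambda>x. complex_of_real (g x) + \<i> * complex_of_real (sqrt (1 - (g x)\<^sup>2)))"
    by (auto simp: w_def complex_eq_iff)
  have "continuous_on UNIV w" unfolding w_eq by (intro continuous_intros g)
  then have cw: "continuous_on UNIV w" "continuous_on UNIV (\<lambda>x. cnj (w x))"
    by (auto intro: continuous_on_cnj)
  have ww: "cnj (w x) * w x = 1" "w x * cnj (w x) = 1" for x
    using sq[of x] by (auto simp: w_def complex_eq_iff power2_eq_square)
  have 1: "p (monomial w 0) \<le> 1" "p (monomial (\<lambda>x. cnj (w x)) 0) \<le> 1"
    using cw by (auto intro!: p_isometry_le_1 simp: monomial_adj monomial_mult ww one_eq_monomial)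
  have "monomial (\<lambda>x. complex_of_real (g x)) 0 = (1 / 2) \<odot>\<^bsub>R\<^esub> (monomial w 0 \<oplus>\<^bsub>R\<^esub> monomial (\<lambda>x. cnj (w x)) 0)"
    unfolding monomial_add monomial_smult
    by (intro arg_cong2[where f = monomial] ext refl) (simp add: w_def complex_eq_iff)
  then have "p (monomial (\<lambda>x. complex_of_real (g x)) 0) = 1 / 2 * p (monomial w 0 \<oplus>\<^bsub>R\<^esub> monomial (\<lambda>x. cnj (w x)) 0)"
    using cw p_smult[of "monomial w 0 \<oplus>\<^bsub>R\<^esub> monomial (\<lambda>x. cnj (w x)) 0" "1 / 2"] by (simp add: crossed_add_closed)
  also have "\<dots> \<le> 1 / 2 * (p (monomial w 0) + p (monomial (\<lambda>x. cnj (w x)) 0))"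
    using cw by (intro mult_left_mono p_add) auto
  also have "\<dots> \<le> 1" using 1 by simp
  finally show ?thesis .
qed

text \<open>The C*-identity replaces f by |f|^2 = B^2 g with g valued in [0, 1], where
  \<open>p_real_le_1\<close> applies; the unitary U^k contributes a factor of at most 1.\<close>

lemma p_monomial_le:
  assumes f: "continuous_on UNIV f" and B: "B > 0" "\<And>x. cmod (f x) \<le> B"
  shows "p (monomial f k) \<le> B"
proof -
  have V: "p (monomial (\<lambda>_. 1) k) \<le> 1"
    by (rule p_isometry_le_1) (simp_all add: monomial_adj monomial_mult one_eq_monomial)
  define g where "g x = (cmod (f x) / B)\<^sup>2" for x
  have cg: "continuous_on UNIV g" unfolding g_def by (intro continuous_intros f) (use B in auto)
  have "g x \<le> 1" for x using B unfolding g_def by (simp add: power_le_one)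
  then have g: "p (monomial (\<lambda>x. complex_of_real (g x)) 0) \<le> 1"
    by (intro p_real_le_1 cg) (auto simp: g_def)
  have "adj R (monomial f 0) \<otimes>\<^bsub>R\<^esub> monomial f 0 = complex_of_real (B\<^sup>2) \<odot>\<^bsub>R\<^esub> monomial (\<lambda>x. complex_of_real (g x)) 0"
  proof -
    have "cnj (f x) * f x = complex_of_real (B\<^sup>2) * complex_of_real (g x)" for x
      using B complex_norm_square[of "f x"] by (simp add: g_def power_divide mult.commute)
    then show ?thesis by (simp add: monomial_adj monomial_mult monomial_smult)
  qed
  then have "(p (monomial f 0))\<^sup>2 = B\<^sup>2 * p (monomial (\<lambda>x. complex_of_real (g x)) 0)"
    using p_adj_mult[of "monomial f 0"] p_smult[of "monomial (\<lambda>x. complex_of_real (g x)) 0" "complex_of_real (B\<^sup>2)"] f cg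
    by (simp add: continuous_on_of_real norm_power)
  also have "\<dots> \<le> B\<^sup>2" using g B by (intro mult_left_le) auto
  finally have p0: "p (monomial f 0) \<le> B" by (rule power2_le_imp_le) (use B in simp)
  have "monomial f k = monomial f 0 \<otimes>\<^bsub>R\<^esub> monomial (\<lambda>_. 1) k" by (simp add: monomial_mult)
  then have "p (monomial f k) \<le> p (monomial f 0) * p (monomial (\<lambda>_. 1) k)" using p_mult f by simp
  also have "\<dots> \<le> B * 1" using p0 V f B by (intro mult_mono p_nonneg) auto
  finally show ?thesis by simp
qed

lemma p_le_sum:
  assumes "finite K" "\<And>k. k \<notin> K \<Longrightarrow> a k = (\<lambda>_. 0)" "\<And>k. continuous_on UNIV (a k)"
    "\<And>k. B k > 0" "\<And>k x. cmod (a k x) \<le> B k"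
  shows "p a \<le> (\<Sum>k\<in>K. B k)"
  using assms
proof (induction K arbitrary: a rule: finite_induct)
  case empty
  then have "a = 0 \<odot>\<^bsub>R\<^esub> \<zero>\<^bsub>R\<^esub>" by (auto simp: crossed_simps fun_eq_iff)
  then have "p a = cmod 0 * p \<zero>\<^bsub>R\<^esub>" using p_smult[of "\<zero>\<^bsub>R\<^esub>" 0] by (simp only: zero_closed)
  then show ?case by simp
next
  case (insert k K)
  define b where "b = a(k := (\<lambda>_. 0))"
  have b: "\<And>j. j \<notin> K \<Longrightarrow> b j = (\<lambda>_. 0)" "\<And>j. continuous_on UNIV (b j)" "\<And>j x. cmod (b j x) \<le> B j"
    using insert.prems by (auto simp: b_def less_imp_le)
  then have "support b \<subseteq> K" by (auto simp: support_def)
  with b insert.hyps have bc: "b \<in> carrier R" by (auto simp: carrier_iff intro: finite_subset)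
  have "a = monomial (a k) k \<oplus>\<^bsub>R\<^esub> b" by (auto simp: b_def monomial_def crossed_simps fun_eq_iff)
  then have "p a \<le> p (monomial (a k) k) + p b"
    using p_add[OF monomial_closed bc] insert.prems by metis
  also have "\<dots> \<le> B k + (\<Sum>k\<in>K. B k)"
    using insert.prems b by (intro add_mono p_monomial_le insert.IH) auto
  finally show ?case using insert.hyps by simp
qed

end

text \<open>Compactness of \<open>[0,\<infinity>]\<close> supplies the coefficient bounds needed for
  \<open>seminorms_bounded\<close>.\<close>

lemma continuous_ennreal_bounded:
  fixes f :: "ennreal \<Rightarrow> complex"
  assumes "continuous_on UNIV f"
  shows "\<exists>B>0. \<forall>x. cmod (f x) \<le> B"
proof -
  have "compact (range f)"
    using assms compact_UNIV by (rule compact_continuous_image)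
  then have "bounded (range f)" by (rule compact_imp_bounded)
  then show ?thesis unfolding bounded_pos by auto
qed

end

sublocale crossed_product \<subseteq> bounded_star_algebra "crossed q"
proof
  show "0 \<odot>\<^bsub>crossed q\<^esub> \<zero>\<^bsub>crossed q\<^esub> = \<zero>\<^bsub>crossed q\<^esub>" by (simp add: crossed_simps)
  fix a assume a: "a \<in> carrier (crossed q)"
  show "- 1 \<odot>\<^bsub>crossed q\<^esub> a = \<ominus>\<^bsub>crossed q\<^esub> a" using a by (simp add: minus_eq_smult)
  have "\<exists>B>0. \<forall>x. cmod (a k x) \<le> B" for k
    using a continuous_ennreal_bounded[of "a k"] by (auto simp: carrier_iff)
  then obtain B where "\<And>k. B k > 0" "\<And>k x. cmod (a k x) \<le> B k" by metis
  then have "p a \<le> (\<Sum>k\<in>support a. B k)" if "cstar_seminorm (crossed q) p" for p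
    using p_le_sum[OF that, of "support a" a B] a by (simp add: carrier_iff not_support)
  then show "\<exists>B. \<forall>p. cstar_seminorm (crossed q) p \<longrightarrow> p a \<le> B" by blast
qed

section \<open>The finite sums of the quantum sphere\<close>

context crossed_product
begin

text \<open>The points 0 and infinity are fixed by the scaling, so \<open>alpha\<close> leaves
  boundary values unchanged. In a product of nonzero total degree at least one factor has nonzero
  degree and vanishes there.\<close>

lemma star_subring_sphere_sums: "star_subring (sphere_sums q)"
proof -
  have E: "a \<in> sphere_sums q \<longleftrightarrow> a \<in> carrier R \<and> (\<forall>k. k \<noteq> 0 \<longrightarrow> a k 0 = 0 \<and> a k top_class.top = 0)" for a
    by (simp add: sphere_sums_def)
  have "a \<otimes>\<^bsub>R\<^esub> b \<in> sphere_sums q" if "a \<in> sphere_sums q" "b \<in> sphere_sums q" for a b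
  proof -
    have z: "a k 0 * b (m - k) 0 = 0" "a k top_class.top * b (m - k) top_class.top = 0" if "m \<noteq> 0" for k m
      using \<open>a \<in> sphere_sums q\<close> \<open>b \<in> sphere_sums q\<close> that by (cases "k = 0"; simp add: E)+
    show ?thesis
      using that by (simp add: E mult_support z)
  qed
  moreover have "\<ominus>\<^bsub>R\<^esub> a \<in> sphere_sums q" if "a \<in> sphere_sums q" for a
    using that by (auto simp: E minus_eq_smult crossed_smult_closed) (auto simp: crossed_simps)
  moreover have "adj R a \<in> sphere_sums q" if "a \<in> sphere_sums q" for a
    using that by (simp add: E crossed_adj_closed) (simp add: crossed_simps(7))
  moreover have "a \<oplus>\<^bsub>R\<^esub> b \<in> sphere_sums q" if "a \<in> sphere_sums q" "b \<in> sphere_sums q" for a b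
    using that by (auto simp: E crossed_add_closed) (auto simp: crossed_simps)
  moreover have "\<one>\<^bsub>R\<^esub> \<in> sphere_sums q" "\<zero>\<^bsub>R\<^esub> \<in> sphere_sums q"
    by (auto simp: E) (auto simp: crossed_simps)
  ultimately show ?thesis
    unfolding star_subring_def by (auto simp: E)
qed

lemma C_sphere_eq: "C_sphere q = completion (sphere_sums q)"
  unfolding C_sphere_def by (rule closure_eq_completion[OF star_subring_sphere_sums])

end

sublocale crossed_product \<subseteq> sphere: star_ring "C_sphere q"
  unfolding C_sphere_eq by (rule star_ring_completion[OF star_subring_sphere_sums])

section \<open>Small matrices of coisometries\<close>

lemma mat2_simps [simp]:
  "dim_row (mat2 a b c d) = 2" "dim_col (mat2 a b c d) = 2"
  "mat2 a b c d $$ (0, 0) = a" "mat2 a b c d $$ (0, Suc 0) = b"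
  "mat2 a b c d $$ (Suc 0, 0) = c" "mat2 a b c d $$ (Suc 0, Suc 0) = d"
  by (simp_all add: mat2_def mat_of_rows_list_def)

lemma mat1_simps [simp]:
  "dim_row (mat1 a) = 1" "dim_col (mat1 a) = 1" "mat1 a $$ (0, 0) = a"
  by (simp_all add: mat1_def mat_of_rows_list_def)

lemma mat2_eqI:
  assumes "dim_row M = 2" "dim_col M = 2" "M $$ (0, 0) = a" "M $$ (0, Suc 0) = b"
    "M $$ (Suc 0, 0) = c" "M $$ (Suc 0, Suc 0) = d"
  shows "M = mat2 a b c d"
  by (rule eq_matI) (use assms in \<open>auto simp: less_2_cases_iff\<close>)

lemma mat1_eqI:
  assumes "dim_row M = 1" "dim_col M = 1" "M $$ (0, 0) = a"
  shows "M = mat1 a"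
  by (rule eq_matI) (use assms in auto)

context star_ring
begin

lemma finsum_1: "f 0 \<in> carrier A \<Longrightarrow> (\<Oplus>k\<in>{..<Suc 0}. f k) = f 0"
  by (simp add: lessThan_Suc)

lemma finsum_2: "f 0 \<in> carrier A \<Longrightarrow> f (Suc 0) \<in> carrier A \<Longrightarrow> (\<Oplus>k\<in>{..<2}. f k) = f 0 \<oplus> f (Suc 0)"
  by (simp add: numeral_2_eq_2 lessThan_Suc a_comm)

lemma mat2_closed:
  "\<lbrakk>a \<in> carrier A; b \<in> carrier A; c \<in> carrier A; d \<in> carrier A\<rbrakk> \<Longrightarrow> mat2 a b c d \<in> mat_over A 2 2"
  by (rule mat_overI) (auto simp: less_2_cases_iff)

lemma mat1_closed: "a \<in> carrier A \<Longrightarrow> mat1 a \<in> mat_over A 1 1"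
  by (rule mat_overI) auto

lemma madj_mat2: "madj A (mat2 a b c d) = mat2 (adj A a) (adj A c) (adj A b) (adj A d)"
  by (rule mat2_eqI) (auto simp: index_madj)

lemma mmul_mat2:
  assumes "a \<in> carrier A" "b \<in> carrier A" "c \<in> carrier A" "d \<in> carrier A"
    "a' \<in> carrier A" "b' \<in> carrier A" "c' \<in> carrier A" "d' \<in> carrier A"
  shows "mmul A (mat2 a b c d) (mat2 a' b' c' d') =
    mat2 (a \<otimes> a' \<oplus> b \<otimes> c') (a \<otimes> b' \<oplus> b \<otimes> d') (c \<otimes> a' \<oplus> d \<otimes> c') (c \<otimes> b' \<oplus> d \<otimes> d')"
  by (rule mat2_eqI) (use assms in \<open>auto simp: index_mmul finsum_2\<close>)

lemma mat1_projs:
  assumes "a \<in> carrier A" "adj A a = a" "a \<otimes> a = a"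
  shows "mat1 a \<in> projs A"
proof -
  have "madj A (mat1 a) = mat1 a" "mmul A (mat1 a) (mat1 a) = mat1 a"
    by (rule mat1_eqI; use assms in \<open>simp add: index_madj index_mmul finsum_1\<close>)+
  then show ?thesis using mat1_closed[of a] assms by (simp add: projs_def)
qed

text \<open>The column (a, b) is itself the rectangular witness. Whether the two matrices are
  projections is checked where this is applied.\<close>

lemma mvn_column_mat1:
  assumes "a \<in> carrier A" "b \<in> carrier A"
  shows "mvn_equiv A (mat2 (a \<otimes> adj A a) (a \<otimes> adj A b) (b \<otimes> adj A a) (b \<otimes> adj A b))
    (mat1 (adj A a \<otimes> a \<oplus> adj A b \<otimes> b))"
proof -
  define v where "v = mat 2 1 (\<lambda>(i, j). if i = 0 then a else b)"
  have "v \<in> mat_over A 2 1" by (rule mat_overI) (use assms in \<open>auto simp: v_def\<close>)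
  moreover have "mmul A v (madj A v) = mat2 (a \<otimes> adj A a) (a \<otimes> adj A b) (b \<otimes> adj A a) (b \<otimes> adj A b)"
    by (rule mat2_eqI) (use assms in \<open>auto simp: v_def index_mmul index_madj finsum_1\<close>)
  moreover have "mmul A (madj A v) v = mat1 (adj A a \<otimes> a \<oplus> adj A b \<otimes> b)"
    by (rule mat1_eqI) (use assms in \<open>auto simp: v_def index_mmul index_madj finsum_2\<close>)
  ultimately show ?thesis unfolding mvn_equiv_def by auto
qed

text \<open>For an isometric column x the middle factor x^* x of y x^* x z collapses to 1. Every
  entry of the later matrix products has this shape.\<close>

lemma isometry_column_mult:
  assumes iso: "adj A x1 \<otimes> x1 \<oplus> adj A x2 \<otimes> x2 = \<one>"
    and c: "x1 \<in> carrier A" "x2 \<in> carrier A" "y \<in> carrier A" "z \<in> carrier A"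
  shows "(y \<otimes> adj A x1) \<otimes> (x1 \<otimes> z) \<oplus> (y \<otimes> adj A x2) \<otimes> (x2 \<otimes> z) = y \<otimes> z"
proof -
  have "(y \<otimes> adj A x1) \<otimes> (x1 \<otimes> z) \<oplus> (y \<otimes> adj A x2) \<otimes> (x2 \<otimes> z)
      = y \<otimes> ((adj A x1 \<otimes> x1 \<oplus> adj A x2 \<otimes> x2) \<otimes> z)"
    using c by (simp add: m_assoc l_distr r_distr)
  then show ?thesis using iso c by simp
qed

lemma coisometry_mult:
  assumes "z \<otimes> adj A z = \<one>" "z \<in> carrier A" "x \<in> carrier A" "y \<in> carrier A"
  shows "(x \<otimes> z) \<otimes> (adj A z \<otimes> y) = x \<otimes> y"
proof -
  have "(x \<otimes> z) \<otimes> (adj A z \<otimes> y) = x \<otimes> ((z \<otimes> adj A z) \<otimes> y)"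
    using assms(2-) by (simp add: m_assoc)
  then show ?thesis using assms by simp
qed

text \<open>Z^* Z is a projection and r its complement. Hence the column y = (r, Z) is isometric,
  and y y^* has diagonal entries r, 1 and zeros elsewhere.\<close>

lemma coisometry_complement:
  assumes Z: "Z \<in> carrier A" "Z \<otimes> adj A Z = \<one>" and r: "r \<in> carrier A" "r \<oplus> adj A Z \<otimes> Z = \<one>"
  shows "adj A r = r" "r \<otimes> r = r" "Z \<otimes> r = \<zero>" "r \<otimes> adj A Z = \<zero>" "\<one> \<ominus> r = adj A Z \<otimes> Z"
proof -
  have "r \<oplus> (\<ominus> r \<oplus> adj A Z \<otimes> Z) = adj A Z \<otimes> Z"
    using Z r by (simp add: r_neg2)
  have e: "r = \<one> \<ominus> adj A Z \<otimes> Z"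
    using Z r by (metis (no_types, lifting) a_minus_def add.inv_solve_right' adj_closed m_closed one_closed a_comm)
  show "\<one> \<ominus> r = adj A Z \<otimes> Z"
    using Z r by (metis (no_types, lifting) a_minus_def add.inv_solve_right' adj_closed m_closed one_closed a_comm)
  show sa: "adj A r = r" unfolding e using Z by (simp add: adj_diff adj_mult)
  have ZZ: "Z \<otimes> (adj A Z \<otimes> Z) = Z" using Z by (simp add: m_assoc[symmetric])
  show Zr: "Z \<otimes> r = \<zero>"
    unfolding e using Z ZZ by (simp add: a_minus_def r_distr r_minus r_neg)
  show "r \<otimes> adj A Z = \<zero>"
    using Zr sa Z r adj_mult[of Z r] by simp
  have "r \<otimes> r = (\<one> \<ominus> adj A Z \<otimes> Z) \<otimes> r" using e by simp
  also have "\<dots> = r \<ominus> adj A Z \<otimes> (Z \<otimes> r)"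
    using Z r by (simp add: a_minus_def l_distr l_minus m_assoc)
  finally show "r \<otimes> r = r" using Zr Z r by (simp add: a_minus_def)
qed

end

section \<open>Continuous functions on \<open>[0,\<infinity>]\<close>\<close>

lemma ext_fun_ennreal: "0 \<le> t \<Longrightarrow> ext_fun f (ennreal t) = of_real (f t)"
  by (simp add: ext_fun_def)

lemma ext_fun_0: "ext_fun f 0 = of_real (f 0)"
  by (simp add: ext_fun_def)

lemma ext_fun_top: "(f \<longlongrightarrow> L) at_top \<Longrightarrow> ext_fun f top_class.top = of_real L"
  by (simp add: ext_fun_def tendsto_Lim)

lemma cnj_ext_fun [simp]: "cnj (ext_fun f x) = ext_fun f x"
  by (simp add: ext_fun_def)

text \<open>Near a finite point \<open>ext_fun f\<close> agrees with f composed with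
  \<open>enn2real\<close>; at infinity continuity is convergence of f to L.\<close>

lemma continuous_ext_fun:
  assumes c: "continuous_on {0..} f" and l: "(f \<longlongrightarrow> L) at_top"
  shows "continuous_on UNIV (ext_fun f)"
proof -
  have "(ext_fun f \<longlongrightarrow> ext_fun f x) (at x)" for x
  proof (cases x)
    case (real t)
    have "((\<lambda>y. f (enn2real y)) \<longlongrightarrow> f t) (at x)"
      by (rule continuous_on_tendsto_compose[OF c]) (use real in \<open>auto intro!: tendsto_enn2real\<close>)
    then have "((\<lambda>y. complex_of_real (f (enn2real y))) \<longlongrightarrow> ext_fun f x) (at x)"
      using real by (auto simp: ext_fun_ennreal intro!: tendsto_of_real)
    moreover have "\<forall>\<^sub>F y in at x. y < top_class.top"
      by (rule order_tendstoD(2)[OF tendsto_ident_at]) (use real in simp)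
    then have "\<forall>\<^sub>F y in at x. complex_of_real (f (enn2real y)) = ext_fun f y"
      by eventually_elim (auto simp: ext_fun_def)
    ultimately show ?thesis using tendsto_cong by force
  next
    case top
    show ?thesis
    proof (rule tendstoI)
      fix e :: real assume "e > 0"
      then have "\<forall>\<^sub>F t in at_top. dist (f t) L < e" using l tendstoD by blast
      then obtain M where M: "\<And>t. t \<ge> M \<Longrightarrow> dist (f t) L < e" by (auto simp: eventually_at_top_linorder)
      \<comment> \<open>The sets above \<open>ennreal M\<close> are neighbourhoods of infinity; a
        negative M is truncated to 0 without harm.\<close>
      have "\<forall>\<^sub>F y in at x. ennreal M < y"
        by (rule order_tendstoD(1)[OF tendsto_ident_at]) (use top in simp)
      then show "\<forall>\<^sub>F y in at x. dist (ext_fun f y) (ext_fun f x) < e"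
      proof eventually_elim
        case (elim y)
        show ?case
        proof (cases y)
          case (real t)
          then have "M \<le> t" using elim by (metis ennreal_leI linorder_not_le less_imp_le)
          then show ?thesis
            using M[of t] real top ext_fun_top[OF l] by (simp add: ext_fun_ennreal dist_of_real)
        qed (use top \<open>e > 0\<close> in simp)
      qed
    qed
  qed
  then show ?thesis by (simp add: continuous_on_def)
qed

lemma ext_fun_eqI:
  assumes "(f \<longlongrightarrow> L) at_top" "\<And>t. t \<ge> 0 \<Longrightarrow> G (ennreal t) = of_real (f t)" "G top_class.top = of_real L"
  shows "ext_fun f = G"
proof
  fix x show "ext_fun f x = G x"
    by (cases x) (use assms in \<open>auto simp: ext_fun_ennreal ext_fun_top\<close>)
qed

context crossed_product
begin

lemma alpha_ennreal: "0 \<le> t \<Longrightarrow> alpha q k f (ennreal t) = f (ennreal (q powi k * t))"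
  using q_pos by (simp add: alpha_def ennreal_mult)

lemma continuous_intros_crossed [simp]:
  fixes f g :: "ennreal \<Rightarrow> complex"
  assumes "continuous_on UNIV f"
  shows "continuous_on UNIV (alpha q k f)" "continuous_on UNIV (\<lambda>x. - f x)"
    "continuous_on UNIV g \<Longrightarrow> continuous_on UNIV (\<lambda>x. f x * g x)"
  using assms by (auto intro: continuous_alpha continuous_on_minus continuous_on_mult)

lemma monomial_sphere_sums:
  "continuous_on UNIV f \<Longrightarrow> (k \<noteq> 0 \<Longrightarrow> f 0 = 0 \<and> f top_class.top = 0) \<Longrightarrow> monomial f k \<in> sphere_sums q"
  using monomial_closed[of f k] by (simp add: sphere_sums_def) (simp add: monomial_def)

lemma sphere_sums_add: "a \<in> sphere_sums q \<Longrightarrow> b \<in> sphere_sums q \<Longrightarrow> a \<oplus>\<^bsub>R\<^esub> b \<in> sphere_sums q"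
  and sphere_sums_adj: "a \<in> sphere_sums q \<Longrightarrow> adj R a \<in> sphere_sums q"
  and sphere_sums_carrier: "a \<in> sphere_sums q \<Longrightarrow> a \<in> carrier R"
  using star_subring_sphere_sums by (auto simp: star_subring_def)

lemma sph_closed: "a \<in> sphere_sums q \<Longrightarrow> sph q a \<in> carrier (C_sphere q)"
  unfolding C_sphere_eq completion_def env_embed_eq using sphere_sums_carrier[of a] by auto

text \<open>\<open>sph\<close> is a unital *-homomorphism. As \<open>C_sphere q\<close> inherits the
  operations of the full enveloping algebra, membership in \<open>carrier R\<close> suffices here;
  \<open>sph_closed\<close> deals with the smaller carrier.\<close>

lemma sph_mult: "a \<in> carrier R \<Longrightarrow> b \<in> carrier R \<Longrightarrow> sph q a \<otimes>\<^bsub>C_sphere q\<^esub> sph q b = sph q (a \<otimes>\<^bsub>R\<^esub> b)"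
  and sph_add: "a \<in> carrier R \<Longrightarrow> b \<in> carrier R \<Longrightarrow> sph q a \<oplus>\<^bsub>C_sphere q\<^esub> sph q b = sph q (a \<oplus>\<^bsub>R\<^esub> b)"
  and sph_adj: "a \<in> carrier R \<Longrightarrow> adj (C_sphere q) (sph q a) = sph q (adj R a)"
  and sph_one: "\<one>\<^bsub>C_sphere q\<^esub> = sph q \<one>\<^bsub>R\<^esub>"
  and sph_zero: "\<zero>\<^bsub>C_sphere q\<^esub> = sph q \<zero>\<^bsub>R\<^esub>"
  unfolding C_sphere_eq completion_def env_embed_eq
  by (simp_all add: env_mult env_add env_adj env_one env_zero)

text \<open>Negation depends on the carrier in which the inverse is sought, so both elements and the
  negative must lie in the sphere sums.\<close>

lemma sph_diff:
  assumes "a \<in> sphere_sums q" "b \<in> sphere_sums q"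
  shows "sph q a \<ominus>\<^bsub>C_sphere q\<^esub> sph q b = sph q (a \<ominus>\<^bsub>R\<^esub> b)"
proof -
  have b: "b \<in> carrier R" "\<ominus>\<^bsub>R\<^esub> b \<in> sphere_sums q" "\<ominus>\<^bsub>R\<^esub> b \<in> carrier R"
    using assms star_subring_sphere_sums sphere_sums_carrier by (auto simp: star_subring_def)
  have "\<ominus>\<^bsub>C_sphere q\<^esub> sph q b = sph q (\<ominus>\<^bsub>R\<^esub> b)"
    using assms b by (intro sphere.minus_equality) (auto simp: sph_closed sph_add sph_zero l_neg)
  then show ?thesis
    using b sphere_sums_carrier[OF assms(1)] by (simp add: a_minus_def sph_add)
qed

end

text \<open>
  \<open>C\<close>, \<open>S\<close> and \<open>c\<close>, \<open>s\<close> are the two profiles,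
  \<open>(c, U\<^sup>n s)\<close> is the isometric column spanning the Bott projection, and
  \<open>Z = \<alpha>\<^sub>q\<^sup>n(C) - U\<^sup>n S\<close> is a coisometry whose initial projection is \<open>1 - R\<^sub>n\<close>.
\<close>

locale profiles = crossed_product +
  fixes n :: nat and C S c s h f :: "ennreal \<Rightarrow> complex"
  assumes n_pos: "n \<ge> 1"
    and cont [simp]: "continuous_on UNIV C" "continuous_on UNIV S" "continuous_on UNIV c"
      "continuous_on UNIV s" "continuous_on UNIV h" "continuous_on UNIV f"
    and real [simp]: "cnj (C x) = C x" "cnj (S x) = S x" "cnj (c x) = c x" "cnj (s x) = s x"
      "cnj (h x) = h x" "cnj (f x) = f x"
    and CS: "C x * C x + S x * S x = 1" and cs: "c x * c x + s x * s x = 1"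
    and CS_disj: "alpha q n C x * S x = 0"
    and h_eq: "C x * S x = h x"
    and f_eq: "f x + alpha q n C x * alpha q n C x + S x * S x = 1"
    and vanish [simp]: "C 0 = 0" "c 0 = 0" "S top_class.top = 0" "s top_class.top = 0"
      "h 0 = 0" "h top_class.top = 0" "f 0 = 0" "f top_class.top = 0"
begin

section \<open>Isometric columns and the coisometry Z\<close>

abbreviation "m \<equiv> int n"

lemma alpha_prod: "alpha q k (\<lambda>x. g x * g' x) = (\<lambda>x. alpha q k g x * alpha q k g' x)" for k g g'
  by (simp add: alpha_def)

lemma alpha_uminus: "alpha q k (\<lambda>x. - g x) = (\<lambda>x. - alpha q k g x)" for k g
  by (simp add: alpha_def)

lemma cnj_alpha [simp]: "cnj (alpha q k g x) = alpha q k (\<lambda>x. cnj (g x)) x" for k g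
  by (simp add: alpha_def)

text \<open>Coefficients are kept to the left of the powers of U, so U^n S is stored as
  \<open>alpha q m S\<close> in degree m. \<open>W\<close> is the unitary V^* and \<open>r\<close>
  is R_n in the same normal form.\<close>

definition Z where "Z = monomial (alpha q m C) 0 \<oplus>\<^bsub>R\<^esub> monomial (\<lambda>x. - alpha q m S x) m"
definition W where "W = monomial (\<lambda>_. 1) (- m)"
definition r where "r = monomial (alpha q m h) m \<oplus>\<^bsub>R\<^esub> monomial f 0 \<oplus>\<^bsub>R\<^esub> monomial h (- m)"
definition x1 where "x1 = monomial c 0"
definition x2 where "x2 = monomial (alpha q m s) m"
definition x1' where "x1' = monomial (alpha q m c) m"
definition x2' where "x2' = monomial s 0"

lemma closed [simp]: "Z \<in> carrier R" "W \<in> carrier R" "r \<in> carrier R" "x1 \<in> carrier R" "x2 \<in> carrier R"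
  "x1' \<in> carrier R" "x2' \<in> carrier R"
  by (simp_all add: Z_def W_def r_def x1_def x2_def x1'_def x2'_def)

lemma adjs: "adj R Z = monomial (alpha q m C) 0 \<oplus>\<^bsub>R\<^esub> monomial (\<lambda>x. - S x) (- m)"
  "adj R W = monomial (\<lambda>_. 1) m"
  "adj R x1 = monomial c 0" "adj R x2 = monomial s (- m)" "adj R x1' = monomial c (- m)" "adj R x2' = monomial s 0"
  by (simp_all add: Z_def W_def x1_def x2_def x1'_def x2'_def adj_add monomial_adj alpha_uminus)

lemma monomial_eqI: "(\<And>x. g x = g' x) \<Longrightarrow> monomial g k = monomial g' k" for g g' k
  by (simp add: monomial_def fun_eq_iff)

lemma monomial_0 [simp]: "monomial (\<lambda>_. 0) k = \<zero>\<^bsub>R\<^esub>" for k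
  by (simp add: monomial_def crossed_simps fun_eq_iff)

text \<open>The last identity is the disjointness condition shifted by \<open>alpha q m\<close>;
  together they kill the coefficients of degrees -m and m in Z Z^* .\<close>

lemma CS_disj': "alpha q m C x * S x = 0" "S x * alpha q m C x = 0"
  "alpha q m S x * alpha q (2 * m) C x = 0"
proof -
  have "alpha q m (\<lambda>x. alpha q m C x * S x) x = 0" by (simp only: CS_disj alpha_const)
  then show "alpha q m S x * alpha q (2 * m) C x = 0"
    by (simp add: alpha_prod mult.commute)
qed (use CS_disj in \<open>simp_all add: mult.commute\<close>)

lemma h_eq': "S x * C x = h x" "C x * S x = h x"
  "alpha q k C x * alpha q k S x = alpha q k h x" "alpha q k S x * alpha q k C x = alpha q k h x" for k
  using h_eq by (simp_all add: alpha_def mult.commute)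

lemma Z_coisometry: "Z \<otimes>\<^bsub>R\<^esub> adj R Z = \<one>\<^bsub>R\<^esub>"
proof -
  have "Z \<otimes>\<^bsub>R\<^esub> adj R Z = monomial (\<lambda>x. alpha q m C x * alpha q m C x) 0 \<oplus>\<^bsub>R\<^esub> monomial (\<lambda>x. - (alpha q m C x * S x)) (- m)
    \<oplus>\<^bsub>R\<^esub> (monomial (\<lambda>x. - (alpha q m S x * alpha q (2 * m) C x)) m \<oplus>\<^bsub>R\<^esub> monomial (\<lambda>x. alpha q m S x * alpha q m S x) 0)"
    unfolding adjs unfolding Z_def by (simp add: l_distr r_distr monomial_mult alpha_uminus a_ac)
  also have "\<dots> = monomial (\<lambda>x. alpha q m C x * alpha q m C x) 0 \<oplus>\<^bsub>R\<^esub> monomial (\<lambda>x. alpha q m S x * alpha q m S x) 0"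
    by (simp add: CS_disj')
  also have "\<dots> = \<one>\<^bsub>R\<^esub>"
    unfolding monomial_add one_eq_monomial by (rule monomial_eqI) (simp add: alpha_def CS)
  finally show ?thesis .
qed

text \<open>Since C S = h, the cross terms of Z^* Z are the negatives of the outer terms of R_n;
  degree zero is \<open>f_eq\<close>.\<close>

lemma r_complement: "r \<oplus>\<^bsub>R\<^esub> adj R Z \<otimes>\<^bsub>R\<^esub> Z = \<one>\<^bsub>R\<^esub>"
proof -
  have ZZ: "adj R Z \<otimes>\<^bsub>R\<^esub> Z = monomial (\<lambda>x. alpha q m C x * alpha q m C x) 0 \<oplus>\<^bsub>R\<^esub> monomial (\<lambda>x. - alpha q m h x) m
    \<oplus>\<^bsub>R\<^esub> (monomial (\<lambda>x. - h x) (- m) \<oplus>\<^bsub>R\<^esub> monomial (\<lambda>x. S x * S x) 0)"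
    unfolding adjs unfolding Z_def
    by (simp add: l_distr r_distr monomial_mult alpha_uminus h_eq' a_ac)
  have "f x + (alpha q m C x * alpha q m C x + S x * S x) = 1" for x
    using f_eq[of x] by (simp add: add.assoc)
  \<comment> \<open>\<open>n_pos\<close> keeps the degrees m, 0 and -m distinct, so coefficients can
    be compared one by one.\<close>
  then show ?thesis
    unfolding ZZ r_def using n_pos by (auto simp: one_eq_monomial monomial_def crossed_simps(5) fun_eq_iff)
qed

text \<open>Records that R_n is a projection, that Z R_n = 0 and that 1 - R_n = Z^* Z, all inherited
  from the coisometry Z.\<close>

lemmas r_simps [simp] = coisometry_complement[OF _ Z_coisometry _ r_complement, simplified]

lemma x_isometry: "adj R x1 \<otimes>\<^bsub>R\<^esub> x1 \<oplus>\<^bsub>R\<^esub> adj R x2 \<otimes>\<^bsub>R\<^esub> x2 = \<one>\<^bsub>R\<^esub>"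
  unfolding adjs by (simp add: x1_def x2_def monomial_mult monomial_add cs one_eq_monomial)

lemma x'_isometry: "adj R x1' \<otimes>\<^bsub>R\<^esub> x1' \<oplus>\<^bsub>R\<^esub> adj R x2' \<otimes>\<^bsub>R\<^esub> x2' = \<one>\<^bsub>R\<^esub>"
  unfolding adjs by (simp add: x1'_def x2'_def monomial_mult monomial_add cs one_eq_monomial)

lemma y_isometry: "adj R r \<otimes>\<^bsub>R\<^esub> r \<oplus>\<^bsub>R\<^esub> adj R Z \<otimes>\<^bsub>R\<^esub> Z = \<one>\<^bsub>R\<^esub>"
  using r_complement by simp

lemma W_unitary: "adj R W \<otimes>\<^bsub>R\<^esub> W = \<one>\<^bsub>R\<^esub>" "W \<otimes>\<^bsub>R\<^esub> adj R W = \<one>\<^bsub>R\<^esub>"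
  unfolding adjs by (simp_all add: W_def monomial_mult one_eq_monomial)

lemma WZ_coisometry: "(W \<otimes>\<^bsub>R\<^esub> Z) \<otimes>\<^bsub>R\<^esub> adj R (W \<otimes>\<^bsub>R\<^esub> Z) = \<one>\<^bsub>R\<^esub>"
  by (simp add: adj_mult coisometry_mult[OF Z_coisometry] W_unitary)

text \<open>The unitary \<open>W\<close> corrects the boundary values without changing the initial
  projection 1 - R_n.\<close>

lemma WZ_initial: "adj R (W \<otimes>\<^bsub>R\<^esub> Z) \<otimes>\<^bsub>R\<^esub> (W \<otimes>\<^bsub>R\<^esub> Z) = adj R Z \<otimes>\<^bsub>R\<^esub> Z"
proof -
  have "adj R (W \<otimes>\<^bsub>R\<^esub> Z) \<otimes>\<^bsub>R\<^esub> (W \<otimes>\<^bsub>R\<^esub> Z) = adj R Z \<otimes>\<^bsub>R\<^esub> ((adj R W \<otimes>\<^bsub>R\<^esub> W) \<otimes>\<^bsub>R\<^esub> Z)"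
    by (simp add: adj_mult m_assoc)
  then show ?thesis by (simp add: W_unitary)
qed

text \<open>After multiplication every coefficient of nonzero degree contains either
  \<open>h\<close> or \<open>f\<close>, which vanish at both ends, or one factor from
  \<open>C\<close>, \<open>c\<close> (zero at 0) together with one from \<open>S\<close>,
  \<open>s\<close> (zero at infinity).\<close>

lemma sphere_entries:
  "r \<in> sphere_sums q" "\<one>\<^bsub>R\<^esub> \<in> sphere_sums q" "\<zero>\<^bsub>R\<^esub> \<in> sphere_sums q"
  "r \<otimes>\<^bsub>R\<^esub> adj R x1 \<in> sphere_sums q" "r \<otimes>\<^bsub>R\<^esub> adj R x2 \<in> sphere_sums q"
  "Z \<otimes>\<^bsub>R\<^esub> adj R x1 \<in> sphere_sums q" "Z \<otimes>\<^bsub>R\<^esub> adj R x2 \<in> sphere_sums q"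
  "x1' \<otimes>\<^bsub>R\<^esub> (W \<otimes>\<^bsub>R\<^esub> Z) \<in> sphere_sums q" "x2' \<otimes>\<^bsub>R\<^esub> (W \<otimes>\<^bsub>R\<^esub> Z) \<in> sphere_sums q"
  "x1 \<otimes>\<^bsub>R\<^esub> adj R x1 \<in> sphere_sums q" "x1 \<otimes>\<^bsub>R\<^esub> adj R x2 \<in> sphere_sums q"
  "x2 \<otimes>\<^bsub>R\<^esub> adj R x1 \<in> sphere_sums q" "x2 \<otimes>\<^bsub>R\<^esub> adj R x2 \<in> sphere_sums q"
  "x1' \<otimes>\<^bsub>R\<^esub> adj R x1' \<in> sphere_sums q" "x1' \<otimes>\<^bsub>R\<^esub> adj R x2' \<in> sphere_sums q"
  "x2' \<otimes>\<^bsub>R\<^esub> adj R x1' \<in> sphere_sums q" "x2' \<otimes>\<^bsub>R\<^esub> adj R x2' \<in> sphere_sums q"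
  unfolding adjs
  unfolding r_def Z_def W_def x1_def x2_def x1'_def x2'_def one_eq_monomial monomial_0[symmetric, of 0]
  by (simp_all add: l_distr r_distr monomial_mult alpha_uminus monomial_sphere_sums sphere_sums_add del: monomial_0)

text \<open>The column need not lie over the sphere algebra; only the four products do. The
  computation takes place in \<open>crossed q\<close> and is then mapped by
  \<open>sph\<close>.\<close>

lemma projs_isometry_column:
  assumes iso: "adj R u \<otimes>\<^bsub>R\<^esub> u \<oplus>\<^bsub>R\<^esub> adj R v \<otimes>\<^bsub>R\<^esub> v = \<one>\<^bsub>R\<^esub>" and c: "u \<in> carrier R" "v \<in> carrier R"
    and e: "u \<otimes>\<^bsub>R\<^esub> adj R u \<in> sphere_sums q" "u \<otimes>\<^bsub>R\<^esub> adj R v \<in> sphere_sums q"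
      "v \<otimes>\<^bsub>R\<^esub> adj R u \<in> sphere_sums q" "v \<otimes>\<^bsub>R\<^esub> adj R v \<in> sphere_sums q"
  shows "mat2 (sph q (u \<otimes>\<^bsub>R\<^esub> adj R u)) (sph q (u \<otimes>\<^bsub>R\<^esub> adj R v)) (sph q (v \<otimes>\<^bsub>R\<^esub> adj R u))
    (sph q (v \<otimes>\<^bsub>R\<^esub> adj R v)) \<in> projs (C_sphere q)"
  unfolding projs_def
  using e c
  by (simp add: sphere.mat2_closed sph_closed sphere.madj_mat2 sphere.mmul_mat2 sph_adj adj_mult
      sph_mult sph_add isometry_column_mult[OF iso])

text \<open>The witness is v = y x^* : isometry of x gives v v^* = y y^*, isometry of y gives v^* v
  = x x^*, and again only the products must lie over the sphere.\<close>

lemma mvn_isometry_columns: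
  assumes x: "adj R x \<otimes>\<^bsub>R\<^esub> x \<oplus>\<^bsub>R\<^esub> adj R x' \<otimes>\<^bsub>R\<^esub> x' = \<one>\<^bsub>R\<^esub>" "x \<in> carrier R" "x' \<in> carrier R"
    and y: "adj R y \<otimes>\<^bsub>R\<^esub> y \<oplus>\<^bsub>R\<^esub> adj R y' \<otimes>\<^bsub>R\<^esub> y' = \<one>\<^bsub>R\<^esub>" "y \<in> carrier R" "y' \<in> carrier R"
    and e: "y \<otimes>\<^bsub>R\<^esub> adj R x \<in> sphere_sums q" "y \<otimes>\<^bsub>R\<^esub> adj R x' \<in> sphere_sums q"
      "y' \<otimes>\<^bsub>R\<^esub> adj R x \<in> sphere_sums q" "y' \<otimes>\<^bsub>R\<^esub> adj R x' \<in> sphere_sums q"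
  shows "mvn_equiv (C_sphere q)
    (mat2 (sph q (y \<otimes>\<^bsub>R\<^esub> adj R y)) (sph q (y \<otimes>\<^bsub>R\<^esub> adj R y')) (sph q (y' \<otimes>\<^bsub>R\<^esub> adj R y)) (sph q (y' \<otimes>\<^bsub>R\<^esub> adj R y')))
    (mat2 (sph q (x \<otimes>\<^bsub>R\<^esub> adj R x)) (sph q (x \<otimes>\<^bsub>R\<^esub> adj R x')) (sph q (x' \<otimes>\<^bsub>R\<^esub> adj R x)) (sph q (x' \<otimes>\<^bsub>R\<^esub> adj R x')))"
proof -
  have e': "x \<otimes>\<^bsub>R\<^esub> adj R y \<in> sphere_sums q" "x' \<otimes>\<^bsub>R\<^esub> adj R y \<in> sphere_sums q"
      "x \<otimes>\<^bsub>R\<^esub> adj R y' \<in> sphere_sums q" "x' \<otimes>\<^bsub>R\<^esub> adj R y' \<in> sphere_sums q"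
    using e[THEN sphere_sums_adj] x(2-) y(2-) by (simp_all add: adj_mult)
  show ?thesis
    unfolding mvn_equiv_def
    by (intro bexI[of _ "mat2 (sph q (y \<otimes>\<^bsub>R\<^esub> adj R x)) (sph q (y \<otimes>\<^bsub>R\<^esub> adj R x'))
          (sph q (y' \<otimes>\<^bsub>R\<^esub> adj R x)) (sph q (y' \<otimes>\<^bsub>R\<^esub> adj R x'))"])
       (use e e' x(2-) y(2-) in \<open>simp_all add: sphere.mat2_closed sph_closed sphere.madj_mat2 sphere.mmul_mat2
         sph_adj adj_mult sph_mult sph_add isometry_column_mult[OF x(1)] isometry_column_mult[OF y(1)]\<close>)
qed

lemma K0_bott:
  "K0_class (C_sphere q) (mat2 (sph q (x1 \<otimes>\<^bsub>R\<^esub> adj R x1)) (sph q (x1 \<otimes>\<^bsub>R\<^esub> adj R x2))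
      (sph q (x2 \<otimes>\<^bsub>R\<^esub> adj R x1)) (sph q (x2 \<otimes>\<^bsub>R\<^esub> adj R x2))) =
     K0_class (C_sphere q) (mat2 (sph q r) \<zero>\<^bsub>C_sphere q\<^esub> \<zero>\<^bsub>C_sphere q\<^esub> \<one>\<^bsub>C_sphere q\<^esub>)" (is "K0_class _ ?P = K0_class _ ?D")
  "K0_class (C_sphere q) (mat1 \<one>\<^bsub>C_sphere q\<^esub>) \<otimes>\<^bsub>K0 (C_sphere q)\<^esub> K0_class (C_sphere q) (mat1 (sph q r)) =
     K0_class (C_sphere q) (mat2 (sph q r) \<zero>\<^bsub>C_sphere q\<^esub> \<zero>\<^bsub>C_sphere q\<^esub> \<one>\<^bsub>C_sphere q\<^esub>)"
  "K0_class (C_sphere q) (mat2 (sph q (x1' \<otimes>\<^bsub>R\<^esub> adj R x1')) (sph q (x1' \<otimes>\<^bsub>R\<^esub> adj R x2'))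
      (sph q (x2' \<otimes>\<^bsub>R\<^esub> adj R x1')) (sph q (x2' \<otimes>\<^bsub>R\<^esub> adj R x2'))) =
     K0_class (C_sphere q) (mat1 (\<one>\<^bsub>C_sphere q\<^esub> \<ominus>\<^bsub>C_sphere q\<^esub> sph q r))" (is "K0_class _ ?P' = _")
proof -
  let ?A = "C_sphere q"
  \<comment> \<open>Recognizes the diagonal matrix as y y^* for y = (R_n, Z), since Z R_n = 0 and Z
    Z^* = 1.\<close>
  have D: "?D = mat2 (sph q (r \<otimes>\<^bsub>R\<^esub> adj R r)) (sph q (r \<otimes>\<^bsub>R\<^esub> adj R Z)) (sph q (Z \<otimes>\<^bsub>R\<^esub> adj R r)) (sph q (Z \<otimes>\<^bsub>R\<^esub> adj R Z))"
    by (simp add: Z_coisometry sph_zero sph_one)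
  have "mvn_equiv ?A ?D ?P"
    unfolding D by (rule mvn_isometry_columns[OF x_isometry _ _ y_isometry]) (simp_all add: sphere_entries)
  moreover have "?P \<in> projs ?A"
    by (rule projs_isometry_column[OF x_isometry]) (simp_all add: sphere_entries)
  moreover have "?D \<in> projs ?A"
    unfolding D by (rule projs_isometry_column[OF y_isometry]) (simp_all add: sphere_entries Z_coisometry)
  ultimately show "K0_class ?A ?P = K0_class ?A ?D"
    by (metis sphere.K0_class_eqI)
  have r: "mat1 (sph q r) \<in> projs ?A" and one: "mat1 \<one>\<^bsub>?A\<^esub> \<in> projs ?A"
    by (rule sphere.mat1_projs; simp add: sph_closed sphere_entries sph_adj sph_mult)+
  have "dsum ?A (mat1 (sph q r)) (mat1 \<one>\<^bsub>?A\<^esub>) = ?D"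
    by (rule mat2_eqI) (simp_all add: sphere.index_dsum)
  \<comment> \<open>The sum [1] + [R_n] puts the unit block first, so the two blocks are
    exchanged.\<close>
  with sphere.K0_class_eqI[OF sphere.mvn_dsum_comm[OF one r] sphere.dsum_projs[OF one r] sphere.dsum_projs[OF r one]] one r
  show "K0_class ?A (mat1 \<one>\<^bsub>?A\<^esub>) \<otimes>\<^bsub>K0 ?A\<^esub> K0_class ?A (mat1 (sph q r)) = K0_class ?A ?D"
    by (simp add: sphere.K0_mult_class sphere.dsum_projs)
  define z where "z = W \<otimes>\<^bsub>R\<^esub> Z"
  have z: "z \<in> carrier R" "z \<otimes>\<^bsub>R\<^esub> adj R z = \<one>\<^bsub>R\<^esub>" "adj R z \<otimes>\<^bsub>R\<^esub> z = adj R Z \<otimes>\<^bsub>R\<^esub> Z"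
    unfolding z_def by (simp_all add: WZ_coisometry WZ_initial)
  have ze: "x1' \<otimes>\<^bsub>R\<^esub> z \<in> sphere_sums q" "x2' \<otimes>\<^bsub>R\<^esub> z \<in> sphere_sums q"
    unfolding z_def by (simp_all add: sphere_entries)
  have minus: "\<one>\<^bsub>?A\<^esub> \<ominus>\<^bsub>?A\<^esub> sph q r = sph q (adj R Z \<otimes>\<^bsub>R\<^esub> Z)"
    unfolding sph_one by (simp add: sph_diff sphere_entries)
  \<comment> \<open>This is v^* v for the column v = x' z: isometry of x' leaves z^* z, which is 1 -
    R_n. The other product reduces to x' x'^* because z z^* = 1.\<close>
  have "(adj R z \<otimes>\<^bsub>R\<^esub> adj R x1') \<otimes>\<^bsub>R\<^esub> (x1' \<otimes>\<^bsub>R\<^esub> z) \<oplus>\<^bsub>R\<^esub> (adj R z \<otimes>\<^bsub>R\<^esub> adj R x2') \<otimes>\<^bsub>R\<^esub> (x2' \<otimes>\<^bsub>R\<^esub> z)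
      = adj R Z \<otimes>\<^bsub>R\<^esub> Z"
    using z by (simp add: isometry_column_mult[OF x'_isometry])
  with sphere.mvn_column_mat1[OF sph_closed[OF ze(1)] sph_closed[OF ze(2)]] z
  have "mvn_equiv ?A ?P' (mat1 (\<one>\<^bsub>?A\<^esub> \<ominus>\<^bsub>?A\<^esub> sph q r))"
    by (simp add: minus sph_adj sph_mult sph_add adj_mult coisometry_mult)
  moreover have "?P' \<in> projs ?A"
    by (rule projs_isometry_column[OF x'_isometry]) (simp_all add: sphere_entries)
  moreover have "mat1 (\<one>\<^bsub>?A\<^esub> \<ominus>\<^bsub>?A\<^esub> sph q r) \<in> projs ?A"
  proof (rule sphere.mat1_projs)
    show "\<one>\<^bsub>?A\<^esub> \<ominus>\<^bsub>?A\<^esub> sph q r \<in> carrier ?A" by (simp add: sph_closed sphere_entries)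
    show "adj ?A (\<one>\<^bsub>?A\<^esub> \<ominus>\<^bsub>?A\<^esub> sph q r) = \<one>\<^bsub>?A\<^esub> \<ominus>\<^bsub>?A\<^esub> sph q r"
      unfolding minus by (simp add: sph_adj adj_mult)
    show "(\<one>\<^bsub>?A\<^esub> \<ominus>\<^bsub>?A\<^esub> sph q r) \<otimes>\<^bsub>?A\<^esub> (\<one>\<^bsub>?A\<^esub> \<ominus>\<^bsub>?A\<^esub> sph q r) = \<one>\<^bsub>?A\<^esub> \<ominus>\<^bsub>?A\<^esub> sph q r"
      unfolding minus by (simp add: sph_mult coisometry_mult[OF Z_coisometry])
  qed
  ultimately show "K0_class ?A ?P' = K0_class ?A (mat1 (\<one>\<^bsub>?A\<^esub> \<ominus>\<^bsub>?A\<^esub> sph q r))"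
    by (rule sphere.K0_class_eqI)
qed

end

section \<open>The profiles of the Bott and Powers--Rieffel projections\<close>

locale bott_data =
  fixes q :: real and n :: nat and \<phi> :: "real \<Rightarrow> real"
  assumes q: "0 < q" "q < 1" and n: "n \<ge> 1"
    and phi_cont: "continuous_on {q..1} \<phi>"
    and phi_range: "\<And>t. t \<in> {q..1} \<Longrightarrow> 0 \<le> \<phi> t \<and> \<phi> t \<le> 1"
    and phi_ends: "\<phi> q = 0" "\<phi> 1 = 1"
begin

sublocale crossed_product q by unfold_locales (rule q)

text \<open>The square of the profile C: clamping the argument to [q, 1] continues
  \<open>\<phi>\<close> by its end values 0 and 1, so continuity needs no gluing.\<close>

definition \<Phi> where "\<Phi> t = \<phi> (max q (min 1 t))"

lemma Phi_eq: "t \<in> {q..1} \<Longrightarrow> \<Phi> t = \<phi> t" "t \<le> q \<Longrightarrow> \<Phi> t = 0" "1 \<le> t \<Longrightarrow> \<Phi> t = 1"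
  using q phi_ends by (auto simp: \<Phi>_def)

lemma Phi_range: "0 \<le> \<Phi> t" "\<Phi> t \<le> 1"
  using phi_range[of "max q (min 1 t)"] q by (auto simp: \<Phi>_def)

lemma Phi_cont: "continuous_on A \<Phi>"
  unfolding \<Phi>_def
  by (rule continuous_on_compose2[OF phi_cont]) (use q in \<open>auto intro!: continuous_intros\<close>)

lemma Phi_lim: "(\<Phi> \<longlongrightarrow> 1) at_top"
  by (rule tendsto_eventually) (auto simp: eventually_at_top_linorder Phi_eq intro!: exI[of _ 1])

lemma qn: "0 < q ^ n" "q ^ n \<le> q"
  using q n by (auto intro: power_le_one_iff[THEN iffD2] simp: power_decreasing[of 1 n q, simplified])

text \<open>If t <= 1 then q^n t <= q^n <= q, as n >= 1. This is the source of the disjointness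
  behind Z Z^* = 1.\<close>

lemma Phi_disj: "\<Phi> (q ^ n * t) = 0 \<or> \<Phi> t = 1"
proof (cases "t \<le> 1")
  case True
  then have "q ^ n * t \<le> q ^ n * 1" using qn by (intro mult_left_mono) auto
  then have "q ^ n * t \<le> q" using qn by linarith
  then show ?thesis by (simp add: Phi_eq(2))
qed (simp add: Phi_eq)

lemma filterlim_qn: "filterlim (\<lambda>t. q ^ n * t) at_top at_top"
  using qn by (intro filterlim_tendsto_pos_mult_at_top[OF tendsto_const]) (auto simp: filterlim_ident)

lemma alpha_ext_fun:
  assumes "(g \<longlongrightarrow> L) at_top"
  shows "alpha q n (ext_fun g) = ext_fun (\<lambda>t. g (q ^ n * t))"
proof (rule ext_fun_eqI[symmetric])
  show "((\<lambda>t. g (q ^ n * t)) \<longlongrightarrow> L) at_top" by (rule filterlim_compose[OF assms filterlim_qn])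
  fix t :: real assume "0 \<le> t"
  then show "alpha q n (ext_fun g) (ennreal t) = of_real (g (q ^ n * t))"
    using q by (simp add: alpha_ennreal ext_fun_ennreal)
qed (simp add: ext_fun_top[OF assms])

text \<open>Both sides rise along \<open>\<phi>\<close> on [q, 1] and fall along its rescaled copy
  on [q^(1-n), q^(-n)]; these intervals share at most an end point. In this form R_n can be compared
  with 1 - Z^* Z.\<close>

lemma pr_f_eq: "0 \<le> t \<Longrightarrow> pr_f q \<phi> n t = \<Phi> t - \<Phi> (q ^ n * t)"
proof -
  assume t: "0 \<le> t"
  have e: "q powr (- real n) = 1 / q ^ n" "q powr (1 - real n) = q / q ^ n" "q powr (- real n + 1) = q / q ^ n"
    using q powr_diff[of q 1 "real n"] by (simp_all add: powr_minus powr_realpow divide_inverse)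
  have ge: "1 \<le> q / q ^ n" "q / q ^ n \<le> 1 / q ^ n" using qn q by (simp_all add: field_simps)
  have c1: "t < q / q ^ n \<longleftrightarrow> q ^ n * t < q" "t \<le> 1 / q ^ n \<longleftrightarrow> q ^ n * t \<le> 1"
    using qn by (simp_all add: field_simps)
  \<comment> \<open>For n = 1 the plateau is empty: the third case is void and the two transitions
    meet at t = 1.\<close>
  consider "t < q" | "q \<le> t" "t \<le> 1" | "1 < t" "q ^ n * t < q" | "1 < t" "q \<le> q ^ n * t" "q ^ n * t \<le> 1"
    | "1 < t" "1 < q ^ n * t" by linarith
  then show ?thesis
  proof cases
    case 1
    have "q ^ n * t \<le> 1 * t" using q t by (intro mult_right_mono) (auto intro: power_le_one)
    then have "\<Phi> (q ^ n * t) = 0" using 1 by (simp add: Phi_eq(2))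
    moreover have "t \<notin> {q..1}" "t \<notin> {1<..<q / q ^ n}" "t \<notin> {q / q ^ n..1 / q ^ n}"
      using 1 ge q unfolding atLeastAtMost_iff greaterThanLessThan_iff by linarith+
    ultimately show ?thesis using 1 by (simp only: pr_f_def e Phi_eq(2) if_False less_imp_le)
  next
    case 2
    have "q ^ n * t \<le> q ^ n * 1" using qn 2 by (intro mult_left_mono) auto
    then have "q ^ n * t \<le> q" using qn by linarith
    with 2 show ?thesis by (simp add: pr_f_def Phi_eq)
  next
    case 3 then show ?thesis by (simp add: pr_f_def e c1 Phi_eq)
  next
    case 4 then show ?thesis using c1 by (auto simp: pr_f_def e Phi_eq not_less[symmetric])
  next
    case 5 then show ?thesis using c1 q ge by (auto simp: pr_f_def e Phi_eq)
  qed
qed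

text \<open>Outside [q, 1] one of the two square roots vanishes, so the cutoff in
  \<open>pr_h\<close> is automatic and h = C S everywhere.\<close>

lemma pr_h_eq: "pr_h q \<phi> t = sqrt (\<Phi> t) * sqrt (1 - \<Phi> t)"
proof (cases "t \<in> {q..1}")
  case True
  then show ?thesis by (simp add: pr_h_def Phi_eq real_sqrt_mult)
next
  case False
  then have "t \<le> q \<or> 1 \<le> t" by auto
  with False show ?thesis by (auto simp: pr_h_def Phi_eq)
qed

lemma pr_lims: "((\<lambda>t. sqrt (\<Phi> t)) \<longlongrightarrow> 1) at_top" "((\<lambda>t. sqrt (1 - \<Phi> t)) \<longlongrightarrow> 0) at_top"
  "(pr_h q \<phi> \<longlongrightarrow> 0) at_top" "(pr_f q \<phi> n \<longlongrightarrow> 0) at_top"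
proof -
  show 1: "((\<lambda>t. sqrt (\<Phi> t)) \<longlongrightarrow> 1) at_top" using tendsto_real_sqrt[OF Phi_lim] by simp
  have "((\<lambda>t. 1 - \<Phi> t) \<longlongrightarrow> 1 - 1) at_top" by (intro tendsto_intros Phi_lim)
  then show 2: "((\<lambda>t. sqrt (1 - \<Phi> t)) \<longlongrightarrow> 0) at_top" using tendsto_real_sqrt by fastforce
  show "(pr_h q \<phi> \<longlongrightarrow> 0) at_top"
    unfolding pr_h_eq using tendsto_mult[OF 1 2] by simp
  have "((\<lambda>t. \<Phi> t - \<Phi> (q ^ n * t)) \<longlongrightarrow> 0) at_top"
    using tendsto_diff[OF Phi_lim filterlim_compose[OF Phi_lim filterlim_qn]] by simp
  then show "(pr_f q \<phi> n \<longlongrightarrow> 0) at_top"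
    by (rule Lim_transform_eventually) (auto simp: eventually_at_top_linorder pr_f_eq intro!: exI[of _ 0])
qed

text \<open>These four constants repeat the local names in \<open>bott_pos\<close> and
  \<open>bott_neg\<close>, so that the unfolded matrices can be folded back.\<close>

definition a where "a = q powr (- real n * (real n - 1))"
definition b where "b = q powr (real n * (real n + 1))"
definition a' where "a' = q powr (- real n / 2 * (real n - 1))"
definition b' where "b' = q powr (real n / 2 * (real n + 1))"

lemma coeff_pos: "a > 0" "b > 0" "a' > 0" "b' > 0"
  using q by (simp_all add: a_def b_def a'_def b'_def)

text \<open>The last equation is the exponent identity n(n+1)/2 = n^2 - n(n-1)/2; it ties the
  constants of the two rows together.\<close>

lemma coeff_sq: "a = a' ^ 2" "b = b' ^ 2" "b' = a' * q ^ (n * n)"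
proof -
  show "a = a' ^ 2" "b = b' ^ 2"
    using q by (simp_all add: a_def b_def a'_def b'_def power2_eq_square powr_add[symmetric])
  have "q ^ (n * n) = q powr (real n * real n)" using q by (simp add: powr_realpow[symmetric])
  then show "b' = a' * q ^ (n * n)"
    unfolding a'_def b'_def using q by (simp add: powr_add[symmetric] field_simps)
qed

section \<open>The profile of the Bott projections\<close>

definition w where "w t = a * t ^ (2 * n)"

lemma w_nonneg [simp]: "0 \<le> w t"
  using coeff_pos by (simp add: w_def)

text \<open>The effect of moving U^n past w: a q^(2 n^2) = b. Hence entries with constant b are
  shifts of those with constant a.\<close>

lemma w_scaled: "w (q ^ n * t) = b * t ^ (2 * n)"
  by (simp add: w_def coeff_sq power_mult_distrib power_mult[symmetric] power2_eq_square mult_2 power_add)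

lemma sqrt_w: "0 \<le> t \<Longrightarrow> sqrt (w t) = a' * t ^ n"
  by (rule real_sqrt_unique)
     (use coeff_pos in \<open>simp_all add: w_def coeff_sq(1) power_mult_distrib power_mult[symmetric] mult.commute\<close>)

lemma sqrt_w_scaled: "0 \<le> t \<Longrightarrow> sqrt (w (q ^ n * t)) = b' * t ^ n"
  unfolding w_scaled coeff_sq(2)
  by (rule real_sqrt_unique)
     (use coeff_pos in \<open>simp_all add: power_mult_distrib power_mult[symmetric] mult.commute\<close>)

text \<open>Cosine and sine of the angle with tangent \<open>sqrt (w t)\<close>, so that their
  product is the off-diagonal coefficient of the Bott projection.\<close>

definition c0 where "c0 t = sqrt (w t / (1 + w t))"
definition s0 where "s0 t = sqrt (1 / (1 + w t))"

lemma one_plus_w [simp]: "1 + w t > 0" "1 + w t \<noteq> 0"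
  using w_nonneg[of t] by linarith+

lemma c0_s0: "c0 t * c0 t = w t / (1 + w t)" "s0 t * s0 t = 1 / (1 + w t)"
  "c0 t * s0 t = sqrt (w t) / (1 + w t)"
  by (simp_all add: c0_def s0_def real_sqrt_divide)

lemma w_lim: "filterlim w at_top at_top"
  unfolding w_def using coeff_pos n
  by (intro filterlim_tendsto_pos_mult_at_top[OF tendsto_const] filterlim_pow_at_top) (auto simp: filterlim_ident)

lemma c0_s0_lims: "(c0 \<longlongrightarrow> 1) at_top" "(s0 \<longlongrightarrow> 0) at_top"
proof -
  have 0: "((\<lambda>t. 1 / (1 + w t)) \<longlongrightarrow> 0) at_top"
    by (rule real_tendsto_divide_at_top[OF tendsto_const])
       (intro filterlim_tendsto_add_at_top[OF tendsto_const w_lim])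
  then have "((\<lambda>t. 1 - 1 / (1 + w t)) \<longlongrightarrow> 1 - 0) at_top" by (intro tendsto_intros)
  moreover have "1 - 1 / (1 + w t) = w t / (1 + w t)" for t by (simp add: field_simps)
  ultimately have 1: "((\<lambda>t. w t / (1 + w t)) \<longlongrightarrow> 1) at_top" by simp
  show "(c0 \<longlongrightarrow> 1) at_top" unfolding c0_def using tendsto_real_sqrt[OF 1] by simp
  show "(s0 \<longlongrightarrow> 0) at_top" unfolding s0_def using tendsto_real_sqrt[OF 0] by simp
qed

lemma w_cont: "continuous_on A w"
  unfolding w_def by (intro continuous_intros)

lemma c0_s0_cont: "continuous_on A c0" "continuous_on A s0"
  unfolding c0_def s0_def by (intro continuous_intros w_cont; simp)+

text \<open>The factorization is given on t >= 0; the value at infinity follows because limits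
  multiply.\<close>

lemma ext_fun_mult:
  assumes "(g \<longlongrightarrow> L) at_top" "(g' \<longlongrightarrow> L') at_top" "\<And>t. t \<ge> 0 \<Longrightarrow> k t = g t * g' t"
  shows "ext_fun k = (\<lambda>x. ext_fun g x * ext_fun g' x)"
proof (rule ext_fun_eqI)
  have "((\<lambda>t. g t * g' t) \<longlongrightarrow> L * L') at_top" by (intro tendsto_mult assms)
  then show "(k \<longlongrightarrow> L * L') at_top"
    by (rule Lim_transform_eventually) (auto simp: eventually_at_top_linorder assms(3) intro!: exI[of _ 0])
qed (use assms in \<open>auto simp: ext_fun_ennreal ext_fun_top\<close>)

sublocale profiles q n "ext_fun (\<lambda>t. sqrt (\<Phi> t))" "ext_fun (\<lambda>t. sqrt (1 - \<Phi> t))" "ext_fun c0" "ext_fun s0"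
  "ext_fun (pr_h q \<phi>)" "ext_fun (pr_f q \<phi> n)"
proof
  show "1 \<le> n" by (rule n)
  have cS: "continuous_on {0..} (\<lambda>t. sqrt (1 - \<Phi> t))" by (intro continuous_intros Phi_cont)
  have cC: "continuous_on {0..} (\<lambda>t. sqrt (\<Phi> t))" by (intro continuous_intros Phi_cont)
  show "continuous_on UNIV (ext_fun (\<lambda>t. sqrt (\<Phi> t)))" "continuous_on UNIV (ext_fun (\<lambda>t. sqrt (1 - \<Phi> t)))"
    using cS cC by (auto intro: continuous_ext_fun pr_lims)
  show "continuous_on UNIV (ext_fun c0)" "continuous_on UNIV (ext_fun s0)"
    by (auto intro: continuous_ext_fun c0_s0_lims c0_s0_cont)
  have "continuous_on {0..} (pr_h q \<phi>)"
    unfolding pr_h_eq[abs_def] by (intro continuous_on_mult cS cC)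
  then show "continuous_on UNIV (ext_fun (pr_h q \<phi>))" by (rule continuous_ext_fun[OF _ pr_lims(3)])
  have "continuous_on {0..} (\<lambda>t. \<Phi> t - \<Phi> (q ^ n * t))"
    by (intro continuous_on_diff Phi_cont continuous_on_compose2[OF Phi_cont[of UNIV]] continuous_intros) auto
  then have "continuous_on {0..} (pr_f q \<phi> n)"
    by (rule continuous_on_eq) (simp add: pr_f_eq)
  then show "continuous_on UNIV (ext_fun (pr_f q \<phi> n))" by (rule continuous_ext_fun[OF _ pr_lims(4)])
  note tops = ext_fun_top[OF pr_lims(1)] ext_fun_top[OF pr_lims(2)] ext_fun_top[OF pr_lims(3)]
    ext_fun_top[OF pr_lims(4)] ext_fun_top[OF c0_s0_lims(1)] ext_fun_top[OF c0_s0_lims(2)]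
  fix x
  \<comment> \<open>Simplification turns the product of a square root with itself into an absolute
    value, which the bounds on \<open>\<Phi>\<close> remove.\<close>
  have sq: "\<bar>\<Phi> t\<bar> = \<Phi> t" "\<bar>1 - \<Phi> t\<bar> = 1 - \<Phi> t" for t using Phi_range[of t] by auto
  show "ext_fun (\<lambda>t. sqrt (\<Phi> t)) x * ext_fun (\<lambda>t. sqrt (\<Phi> t)) x +
      ext_fun (\<lambda>t. sqrt (1 - \<Phi> t)) x * ext_fun (\<lambda>t. sqrt (1 - \<Phi> t)) x = 1"
    by (cases x) (auto simp: ext_fun_ennreal tops sq simp flip: of_real_mult of_real_add)
  have cs1: "c0 t * c0 t + s0 t * s0 t = 1" for t
    by (simp add: c0_s0 add_divide_distrib[symmetric] add.commute)
  show "ext_fun c0 x * ext_fun c0 x + ext_fun s0 x * ext_fun s0 x = 1"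
    by (cases x) (auto simp: ext_fun_ennreal tops cs1 simp flip: of_real_mult of_real_add)
  show "alpha q (int n) (ext_fun (\<lambda>t. sqrt (\<Phi> t))) x * ext_fun (\<lambda>t. sqrt (1 - \<Phi> t)) x = 0"
    using Phi_disj q by (cases x) (auto simp: alpha_ennreal ext_fun_ennreal tops)
  show "ext_fun (\<lambda>t. sqrt (\<Phi> t)) x * ext_fun (\<lambda>t. sqrt (1 - \<Phi> t)) x = ext_fun (pr_h q \<phi>) x"
    by (cases x) (auto simp: ext_fun_ennreal tops pr_h_eq)
  show "ext_fun (pr_f q \<phi> n) x +
      alpha q (int n) (ext_fun (\<lambda>t. sqrt (\<Phi> t))) x * alpha q (int n) (ext_fun (\<lambda>t. sqrt (\<Phi> t))) x +
      ext_fun (\<lambda>t. sqrt (1 - \<Phi> t)) x * ext_fun (\<lambda>t. sqrt (1 - \<Phi> t)) x = 1"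
    using q by (cases x) (auto simp: alpha_ennreal ext_fun_ennreal tops sq pr_f_eq simp flip: of_real_mult of_real_add)
\<comment> \<open>What remains is reality and the boundary values; \<open>c0 0 = 0\<close> uses n >=
  1, since t^(2n) has to vanish at 0.\<close>
qed (use n q in \<open>auto simp: ext_fun_0 ext_fun_top[OF pr_lims(2)] ext_fun_top[OF pr_lims(3)] ext_fun_top[OF pr_lims(4)]
    ext_fun_top[OF c0_s0_lims(2)] Phi_eq pr_h_def pr_f_eq c0_def w_def\<close>)

section \<open>The given projections in terms of monomials\<close>

lemma map_mat2: "map_mat g (mat2 u v u' v') = mat2 (g u) (g v) (g u') (g v')"
  by (rule mat2_eqI) auto

lemma Fn_eq_monomial: "Fn g = monomial (ext_fun g) 0"
  by (simp add: Fn_def monomial_def fun_eq_iff)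

lemma U_pow: "U [^]\<^bsub>R\<^esub> n = monomial (\<lambda>_. 1) m" "adj R U [^]\<^bsub>R\<^esub> n = monomial (\<lambda>_. 1) (- m)"
  by (simp_all add: U_eq_monomial monomial_adj monomial_pow)

text \<open>Entries with constants \<open>a\<close>, \<open>a'\<close> are products of the profiles
  themselves, those with \<open>b\<close>, \<open>b'\<close> are the same products shifted by
  \<open>alpha q m\<close>; this exhibits the Bott matrices as column times adjoint.\<close>

lemma bott_functions:
  "ext_fun (\<lambda>t. a * t ^ (2 * n) / (1 + a * t ^ (2 * n))) = (\<lambda>x. ext_fun c0 x * ext_fun c0 x)"
  "ext_fun (\<lambda>t. 1 / (1 + a * t ^ (2 * n))) = (\<lambda>x. ext_fun s0 x * ext_fun s0 x)"
  "ext_fun (\<lambda>t. a' * t ^ n / (1 + a * t ^ (2 * n))) = (\<lambda>x. ext_fun c0 x * ext_fun s0 x)"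
  "ext_fun (\<lambda>t. b * t ^ (2 * n) / (1 + b * t ^ (2 * n))) = (\<lambda>x. alpha q m (ext_fun c0) x * alpha q m (ext_fun c0) x)"
  "ext_fun (\<lambda>t. 1 / (1 + b * t ^ (2 * n))) = (\<lambda>x. alpha q m (ext_fun s0) x * alpha q m (ext_fun s0) x)"
  "ext_fun (\<lambda>t. b' * t ^ n / (1 + b * t ^ (2 * n))) = (\<lambda>x. alpha q m (ext_fun c0) x * alpha q m (ext_fun s0) x)"
proof -
  note l = c0_s0_lims
  note l' = filterlim_compose[OF l(1) filterlim_qn] filterlim_compose[OF l(2) filterlim_qn]
  show "ext_fun (\<lambda>t. a * t ^ (2 * n) / (1 + a * t ^ (2 * n))) = (\<lambda>x. ext_fun c0 x * ext_fun c0 x)"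
    by (rule ext_fun_mult[OF l(1) l(1)]) (simp add: c0_s0, simp add: w_def)
  show "ext_fun (\<lambda>t. 1 / (1 + a * t ^ (2 * n))) = (\<lambda>x. ext_fun s0 x * ext_fun s0 x)"
    by (rule ext_fun_mult[OF l(2) l(2)]) (simp add: c0_s0, simp add: w_def)
  show "ext_fun (\<lambda>t. a' * t ^ n / (1 + a * t ^ (2 * n))) = (\<lambda>x. ext_fun c0 x * ext_fun s0 x)"
    by (rule ext_fun_mult[OF l(1) l(2)]) (simp add: c0_s0 sqrt_w, simp add: w_def)
  show "ext_fun (\<lambda>t. b * t ^ (2 * n) / (1 + b * t ^ (2 * n))) = (\<lambda>x. alpha q m (ext_fun c0) x * alpha q m (ext_fun c0) x)"
    unfolding alpha_ext_fun[OF l(1)] by (rule ext_fun_mult[OF l'(1) l'(1)]) (simp add: c0_s0 w_scaled)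
  show "ext_fun (\<lambda>t. 1 / (1 + b * t ^ (2 * n))) = (\<lambda>x. alpha q m (ext_fun s0) x * alpha q m (ext_fun s0) x)"
    unfolding alpha_ext_fun[OF l(2)] by (rule ext_fun_mult[OF l'(2) l'(2)]) (simp add: c0_s0 w_scaled)
  show "ext_fun (\<lambda>t. b' * t ^ n / (1 + b * t ^ (2 * n))) = (\<lambda>x. alpha q m (ext_fun c0) x * alpha q m (ext_fun s0) x)"
    unfolding alpha_ext_fun[OF l(1)] alpha_ext_fun[OF l(2)]
    by (rule ext_fun_mult[OF l'(1) l'(2)]) (simp add: c0_s0 sqrt_w_scaled, simp add: w_scaled)
qed

lemma bott_pos_eq:
  "bott_pos q n = mat2 (sph q (x1 \<otimes>\<^bsub>R\<^esub> adj R x1)) (sph q (x1 \<otimes>\<^bsub>R\<^esub> adj R x2))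
      (sph q (x2 \<otimes>\<^bsub>R\<^esub> adj R x1)) (sph q (x2 \<otimes>\<^bsub>R\<^esub> adj R x2))"
  unfolding adjs
  unfolding bott_pos_def Let_def map_mat2 U_pow Fn_eq_monomial
    a_def[symmetric] b_def[symmetric] a'_def[symmetric] b'_def[symmetric] bott_functions
  by (simp add: monomial_mult x1_def x2_def mult.commute)

lemma bott_neg_eq:
  "bott_neg q n = mat2 (sph q (x1' \<otimes>\<^bsub>R\<^esub> adj R x1')) (sph q (x1' \<otimes>\<^bsub>R\<^esub> adj R x2'))
      (sph q (x2' \<otimes>\<^bsub>R\<^esub> adj R x1')) (sph q (x2' \<otimes>\<^bsub>R\<^esub> adj R x2'))"
  unfolding adjs
  unfolding bott_neg_def Let_def map_mat2 U_pow Fn_eq_monomial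
    a_def[symmetric] b_def[symmetric] a'_def[symmetric] b'_def[symmetric] bott_functions
  by (simp add: monomial_mult x1'_def x2'_def mult.commute)

lemma powers_rieffel_eq: "powers_rieffel q \<phi> n = sph q r"
  by (simp add: powers_rieffel_def Let_def U_pow Fn_eq_monomial monomial_mult r_def)

end

theorem corollary11:
  fixes q :: real and n :: nat and \<phi> :: "real \<Rightarrow> real"
  assumes "0 < q" and "q < 1" and "n \<ge> 1"
    and "continuous_on {q..1} \<phi>"
    and "\<forall>t\<in>{q..1}. 0 \<le> \<phi> t \<and> \<phi> t \<le> 1"
    and "\<phi> q = 0" and "\<phi> 1 = 1"
  defines "A \<equiv> C_sphere q"
    and "R \<equiv> powers_rieffel q \<phi> n"
  shows "K0_class A (bott_pos q n) = K0_class A (mat1 \<one>\<^bsub>A\<^esub>) \<otimes>\<^bsub>K0 A\<^esub> K0_class A (mat1 R)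
    \<and> K0_class A (mat1 \<one>\<^bsub>A\<^esub>) \<otimes>\<^bsub>K0 A\<^esub> K0_class A (mat1 R) =
        K0_class A (mat2 R \<zero>\<^bsub>A\<^esub> \<zero>\<^bsub>A\<^esub> \<one>\<^bsub>A\<^esub>)
    \<and> K0_class A (bott_neg q n) = K0_class A (mat1 (\<one>\<^bsub>A\<^esub> \<ominus>\<^bsub>A\<^esub> R))"
proof -
  interpret bott_data q n \<phi>
    by unfold_locales (use assms in auto)
  show ?thesis
    unfolding A_def R_def by (simp add: bott_pos_eq bott_neg_eq powers_rieffel_eq K0_bott)
qed

end
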